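(* Fix an integer $p\ge 2$. Let $T(N,p)$ denote the Turán graph on $N$ vertices with $p$ parts, let $A(N,p)=\mathrm{AO}(T(N,p))$ be its number of acyclic orientations, and put $L=\log\frac{p}{p-1}$. Then, as $N\to\infty$, $$A(N,p)\sim \frac{N!}{(p-1)(1-L)^{(p-1)/2}\,p^N L^{N+1}}.$$
   Context: $\mathrm{AO}(G)$ is the number of acyclic orientations of a finite simple graph $G$. The Turán graph $T(N,p)$ is the complete $p$-partite graph on $N$ vertices whose part sizes differ pairwise by at most $1$. $\log$ is the natural logarithm. $a_N\sim b_N$ means $a_N/b_N\to1$. *)

theory Defs
  imports "HOL-Analysis.Analysis" "HOL-Library.Landau_Symbols" "Graph_Theory.Pair_Digraph"
begin

text \<open>
  A finite simple graph is a \<^locale>\<open>pair_graph\<close>: a loop-free symmetric digraph on finitely many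
  vertices, in which an undirected edge between \<open>u\<close> and \<open>v\<close> is the pair of arcs \<open>(u, v)\<close>, \<open>(v, u)\<close>.
  An orientation is given by its arc set: it keeps exactly one arc of each such pair.
\<close>

definition is_orientation :: "'a pair_pre_digraph \<Rightarrow> ('a \<times> 'a) set \<Rightarrow> bool" where
  "is_orientation G D \<longleftrightarrow>
     D \<subseteq> parcs G \<and> (\<forall>(u, v) \<in> parcs G. (u, v) \<in> D \<longleftrightarrow> (v, u) \<notin> D)"

definition AO :: "'a pair_pre_digraph \<Rightarrow> nat" where
  "AO G = card {D. is_orientation G D \<and> acyclic D}"

text \<open>
  The map \<open>c\<close> sends each vertex to the index of its part.  Parts may be empty, as is
  unavoidable for \<open>N < p\<close>.
\<close>

definition is_turan_graph :: "nat \<Rightarrow> nat \<Rightarrow> 'a pair_pre_digraph \<Rightarrow> bool" where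
  "is_turan_graph N p G \<longleftrightarrow>
     pair_graph G \<and> card (pverts G) = N \<and>
     (\<exists>c :: 'a \<Rightarrow> nat.
        (\<forall>v \<in> pverts G. c v < p) \<and>
        parcs G = {(u, v). u \<in> pverts G \<and> v \<in> pverts G \<and> c u \<noteq> c v} \<and>
        (\<forall>i < p. \<forall>j < p.
           card {v \<in> pverts G. c v = i} \<le> card {v \<in> pverts G. c v = j} + 1))"

lemma is_turan_graph_mod:
  assumes "p > 0"
  shows "is_turan_graph N p
           \<lparr>pverts = {..<N}, parcs = {(u, v). u < N \<and> v < N \<and> u mod p \<noteq> v mod p}\<rparr>"
    (is "is_turan_graph N p ?G")
proof -
  have "finite {(u, v). u < N \<and> v < N \<and> u mod p \<noteq> v mod p}"
    by (rule finite_subset[of _ "{..<N} \<times> {..<N}"]) auto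
  then have "pair_graph ?G"
    by unfold_locales (auto simp: symmetric_def sym_def arcs_ends_def arc_to_ends_def)
  moreover have "card {v \<in> {..<N}. v mod p = i} \<le> card {v \<in> {..<N}. v mod p = j} + 1"
    if ij: "i < p" "j < p" for i j
  proof -
    let ?A = "{v \<in> {..<N}. v mod p = i}" and ?B = "{v \<in> {..<N}. v mod p = j}"
    let ?f = "\<lambda>v. (v div p - 1) * p + j"
    have pos: "v div p \<ge> 1" if "v \<in> ?A - {i}" for v
      using that \<open>p > 0\<close> by (cases "v div p") (auto simp: div_eq_0_iff)
    have "inj_on ?f (?A - {i})"
    proof (rule inj_onI)
      fix v w assume v: "v \<in> ?A - {i}" and w: "w \<in> ?A - {i}" and "?f v = ?f w"
      then have "v div p = w div p"
        using pos[OF v] pos[OF w] \<open>p > 0\<close> by simp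
      then show "v = w"
        using v w by (metis (lifting) DiffD1 div_mult_mod_eq mem_Collect_eq)
    qed
    moreover have "?f ` (?A - {i}) \<subseteq> ?B"
    proof (rule image_subsetI)
      fix v assume v: "v \<in> ?A - {i}"
      then obtain k where k: "v div p = Suc k"
        using pos[of v] by (cases "v div p") auto
      have "v = Suc k * p + v mod p"
        using k by (metis div_mult_mod_eq)
      then have "k * p + j < v"
        using ij by simp
      then show "?f v \<in> ?B"
        using v k ij by simp
    qed
    ultimately have "card (?A - {i}) \<le> card ?B"
      by (intro card_inj_on_le[of ?f]) auto
    then show ?thesis
      by (simp add: card_Diff_singleton_if split: if_splits)
  qed
  ultimately show ?thesis
    unfolding is_turan_graph_def using assms
    by (intro conjI exI[of _ "\<lambda>v. v mod p"]) auto
qed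

end

theory Submission
  imports Defs "HOL-Complex_Analysis.Laurent_Convergence" "HOL-Probability.Characteristic_Functions"
begin

text \<open>
  The sources of an acyclic orientation of a complete multipartite graph form a nonempty subset of
  one part; inclusion-exclusion over this set gives a recurrence in the part sizes, which is solved
  by \<open>\<integral>\<^sub>0\<^sup>\<infinity> exp (- t) \<Prod>\<^sub>i \<phi>\<^bsub>n\<^sub>i\<^esub>(t) dt\<close>,
  where \<open>\<phi>\<^sub>n(t) = n! [x\<^sup>n] exp (t (1 - exp (- x)))\<close>.
  Since \<open>p (1 - exp (- L)) = 1\<close>, scaling \<open>\<phi>\<^sub>n\<close> by \<open>L\<^sup>n exp (- t / p) / n!\<close> absorbs the factor
  \<open>exp (- t)\<close>.  Cauchy's formula on the circle of radius \<open>L\<close> shows that the scaled function is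
  asymptotically a Gaussian with mean \<open>t L exp (- L)\<close> and variance \<open>(1 - L)\<close> times the mean;
  shifting the radius to \<open>L (1 \<plusminus> 1 / \<surd>n)\<close> gives exponential tails, hence dominated convergence of the
  rescaled integral.  The factorials are treated by the same saddle point lemma, applied to the
  Poisson distribution.
\<close>

section \<open>Acyclic orientations of complete multipartite graphs\<close>

text \<open>The equation \<open>p * (1 - exp (- L)) = 1\<close> is also the stationarity condition
  in \<open>t\<close>: with all part sizes near \<open>m = N / p\<close>, every factor has its
  saddle at radius \<open>L\<close>, for \<open>t\<close> near \<open>m / (L * exp (- L))\<close>.
  This is why one radius serves all parts. The obstacle is that \<open>1 - exp (- x)\<close> has
  coefficients of both signs, so the scaled factors are not probability masses and cannot be bounded
  by positivity. The substitute is a quadratic lower bound for the real part of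
  \<open>exp (- z)\<close> on circles of radius below 1; \<open>p \<ge> 2\<close> gives
  \<open>L \<le> ln 2 < 1\<close>, which leaves room to move the radius. Radius \<open>L\<close>
  alone yields a bound of order \<open>1 / sqrt t\<close>, without any decay as \<open>t\<close>
  leaves the centre, hence no integrable majorant after rescaling. Enlarging the radius controls
  small \<open>t\<close>, shrinking it controls large \<open>t\<close>. The part sizes enter only
  through their distance at most 1 from \<open>m\<close> and their sum \<open>N\<close>, so the
  rounding pattern of the parts does not affect the limit. The local limits are therefore stated for
  arbitrary integers within distance 1 of a real centre.\<close>

definition multipartite_arcs :: "('a \<Rightarrow> nat) \<Rightarrow> 'a set \<Rightarrow> ('a \<times> 'a) set" where
  "multipartite_arcs c V = {(u, v). u \<in> V \<and> v \<in> V \<and> c u \<noteq> c v}"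

definition acyclic_orientations :: "('a \<Rightarrow> nat) \<Rightarrow> 'a set \<Rightarrow> ('a \<times> 'a) set set" where
  "acyclic_orientations c V =
     {D. D \<subseteq> multipartite_arcs c V \<and>
         (\<forall>(u, v) \<in> multipartite_arcs c V. (u, v) \<in> D \<longleftrightarrow> (v, u) \<notin> D) \<and> acyclic D}"

definition sources :: "'a set \<Rightarrow> ('a \<times> 'a) set \<Rightarrow> 'a set" where
  "sources V D = {v \<in> V. \<forall>u. (u, v) \<notin> D}"

definition monochromatic :: "('a \<Rightarrow> nat) \<Rightarrow> 'a set \<Rightarrow> bool" where
  "monochromatic c S \<longleftrightarrow> (\<forall>u\<in>S. \<forall>v\<in>S. c u = c v)"

lemma finite_multipartite_arcs: "finite V \<Longrightarrow> finite (multipartite_arcs c V)"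
  by (rule finite_subset[of _ "V \<times> V"]) (auto simp: multipartite_arcs_def)

lemma finite_acyclic_orientations: "finite V \<Longrightarrow> finite (acyclic_orientations c V)"
  by (rule finite_subset[of _ "Pow (multipartite_arcs c V)"])
    (auto simp: acyclic_orientations_def finite_multipartite_arcs)

lemma finite_acyclic_orientation:
  "finite V \<Longrightarrow> D \<in> acyclic_orientations c V \<Longrightarrow> finite D"
  unfolding acyclic_orientations_def using finite_multipartite_arcs finite_subset by blast

lemma sources_nonempty:
  assumes "finite V" "V \<noteq> {}" "D \<in> acyclic_orientations c V"
  shows "sources V D \<noteq> {}"
proof -
  have "wf D"
    using assms finite_acyclic_orientation
    by (intro finite_acyclic_wf) (auto simp: acyclic_orientations_def)
  moreover obtain x where "x \<in> V"
    using assms by auto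
  ultimately obtain z where "z \<in> V" "\<And>y. (y, z) \<in> D \<Longrightarrow> y \<notin> V"
    by (rule wfE_min) auto
  moreover have "D \<subseteq> V \<times> V"
    using assms by (auto simp: acyclic_orientations_def multipartite_arcs_def)
  ultimately show ?thesis
    unfolding sources_def by blast
qed

text \<open>Two vertices of different colours are joined by an arc, and the head of that arc is not
  a source.\<close>

lemma monochromatic_sources:
  assumes "D \<in> acyclic_orientations c V" "S \<subseteq> sources V D"
  shows "monochromatic c S"
  unfolding monochromatic_def
proof (intro ballI, rule ccontr)
  fix u v assume "u \<in> S" "v \<in> S" "c u \<noteq> c v"
  then have "u \<in> V" "v \<in> V" "(u, v) \<notin> D" "(v, u) \<notin> D" "(u, v) \<in> multipartite_arcs c V"
    using assms(2) by (auto simp: multipartite_arcs_def sources_def)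
  then show False
    using assms(1) by (auto simp: acyclic_orientations_def)
qed

text \<open>Making every vertex of \<open>S\<close> a source forces all arcs at \<open>S\<close> to
  point out of it, and a monochromatic \<open>S\<close> has no arcs inside. The orientation of the
  rest stays free. Asking for containment in the sources, not equality, is what leaves it
  unconstrained.\<close>

lemma card_orientations_with_sources:
  assumes "finite V" "S \<subseteq> V" "monochromatic c S"
  shows "card {D \<in> acyclic_orientations c V. S \<subseteq> sources V D}
       = card (acyclic_orientations c (V - S))"
proof -
  let ?W = "V - S"
  define X where "X = multipartite_arcs c V \<inter> S \<times> ?W"
  have acyc: "acyclic (D \<union> X)" if D: "D \<in> acyclic_orientations c ?W" for D
  proof -
    have "wf D"
      using assms(1) D finite_acyclic_orientation[of ?W D c]
      by (intro finite_acyclic_wf) (auto simp: acyclic_orientations_def)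
    \<comment> \<open>All arcs of \<open>X\<close> run from \<open>S\<close> to its complement, so
      no two of them compose.\<close>
    moreover have "wf X"
      by (rule wf_no_loop) (auto simp: X_def)
    moreover have "D \<subseteq> ?W \<times> ?W"
      using D by (auto simp: acyclic_orientations_def multipartite_arcs_def)
    \<comment> \<open>\<open>wf_Un\<close> asks that the domain of the first relation miss the range
      of the second: \<open>X\<close> starts in \<open>S\<close>, while \<open>D\<close> ends
      outside it.\<close>
    ultimately have "wf (X \<union> D)"
      by (intro wf_Un) (auto simp: X_def)
    then show ?thesis
      by (simp add: Un_commute wf_acyclic)
  qed
  have "bij_betw (\<lambda>D. D \<inter> ?W \<times> ?W) {D \<in> acyclic_orientations c V. S \<subseteq> sources V D}
          (acyclic_orientations c ?W)"
  proof (rule bij_betw_byWitness[where f' = "\<lambda>D. D \<union> X"])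
    show "\<forall>D\<in>{D \<in> acyclic_orientations c V. S \<subseteq> sources V D}. D \<inter> ?W \<times> ?W \<union> X = D"
    proof
      fix D assume "D \<in> {D \<in> acyclic_orientations c V. S \<subseteq> sources V D}"
      then have sub: "D \<subseteq> multipartite_arcs c V"
        and flip: "\<And>u v. (u, v) \<in> multipartite_arcs c V \<Longrightarrow> (u, v) \<in> D \<longleftrightarrow> (v, u) \<notin> D"
        and src: "\<And>u v. v \<in> S \<Longrightarrow> (u, v) \<notin> D"
        by (auto simp: acyclic_orientations_def sources_def)
      have "X \<subseteq> D"
        using flip src by (auto simp: X_def)
      moreover have "D \<subseteq> D \<inter> ?W \<times> ?W \<union> X"
        using sub src by (auto simp: X_def multipartite_arcs_def)
      ultimately show "D \<inter> ?W \<times> ?W \<union> X = D"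
        by blast
    qed
    show "\<forall>D\<in>acyclic_orientations c ?W. (D \<union> X) \<inter> ?W \<times> ?W = D"
      by (auto simp: acyclic_orientations_def multipartite_arcs_def X_def)
    show "(\<lambda>D. D \<inter> ?W \<times> ?W) ` {D \<in> acyclic_orientations c V. S \<subseteq> sources V D}
            \<subseteq> acyclic_orientations c ?W"
      by (auto simp: acyclic_orientations_def multipartite_arcs_def intro: acyclic_subset)
    show "(\<lambda>D. D \<union> X) ` acyclic_orientations c ?W
            \<subseteq> {D \<in> acyclic_orientations c V. S \<subseteq> sources V D}"
    proof (rule image_subsetI)
      fix D assume D: "D \<in> acyclic_orientations c ?W"
      have "D \<union> X \<subseteq> multipartite_arcs c V"
        using D by (auto simp: acyclic_orientations_def multipartite_arcs_def X_def)
      moreover have "(u, v) \<in> D \<union> X \<longleftrightarrow> (v, u) \<notin> D \<union> X"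
        if "(u, v) \<in> multipartite_arcs c V" for u v
      proof -
        have "u \<in> V" "v \<in> V" "c u \<noteq> c v" "\<not> (u \<in> S \<and> v \<in> S)"
          using that assms(3) by (auto simp: multipartite_arcs_def monochromatic_def)
        then show ?thesis
          using D by (auto simp: acyclic_orientations_def multipartite_arcs_def X_def)
      qed
      moreover have "S \<subseteq> sources V (D \<union> X)"
        using D assms(2)
        by (auto simp: acyclic_orientations_def multipartite_arcs_def X_def sources_def)
      ultimately show "D \<union> X \<in> {D \<in> acyclic_orientations c V. S \<subseteq> sources V D}"
        using acyc[OF D] by (auto simp: acyclic_orientations_def)
    qed
  qed
  then show ?thesis
    by (rule bij_betw_same_card)
qed

lemma sum_alternating_nonempty_subsets:
  assumes "finite X" "X \<noteq> {}"
  shows "(\<Sum>S | S \<subseteq> X \<and> S \<noteq> {}. (-1) ^ (card S + 1)) = (1 :: 'b :: comm_ring_1)"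
proof -
  have "(\<Sum>S\<in>Pow X. (-1) ^ card S) = (\<Prod>x\<in>X. 1 - 1 :: 'b)"
    using assms by (subst prod_diff_conv_sum) simp_all
  also have "\<dots> = 0"
    using assms by (simp add: power_0_left)
  also have "Pow X = insert {} {S. S \<subseteq> X \<and> S \<noteq> {}}"
    by auto
  finally show ?thesis
    using assms by (simp add: sum_negf add_eq_0_iff)
qed

text \<open>Each orientation is counted as the alternating sum over the nonempty subsets of its
  sources, which is 1 because sources exist. After exchanging the sums, only containment counts
  remain, and these are counts for smaller vertex sets.\<close>

lemma card_acyclic_orientations_rec:
  assumes "finite V" "V \<noteq> {}"
  shows "of_nat (card (acyclic_orientations c V)) =
    (\<Sum>S | S \<subseteq> V \<and> S \<noteq> {} \<and> monochromatic c S.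
       (-1) ^ (card S + 1) * of_nat (card (acyclic_orientations c (V - S))) :: 'b :: comm_ring_1)"
proof -
  let ?O = "acyclic_orientations c V"
  let ?M = "{S. S \<subseteq> V \<and> S \<noteq> {} \<and> monochromatic c S}"
  have fin: "finite ?O" "finite ?M"
    using assms by (auto simp: finite_acyclic_orientations)
  have "of_nat (card ?O) = (\<Sum>D\<in>?O. 1 :: 'b)"
    by simp
  also have "\<dots> = (\<Sum>D\<in>?O. \<Sum>S | S \<subseteq> sources V D \<and> S \<noteq> {}. (-1) ^ (card S + 1))"
    using assms sources_nonempty
    by (intro sum.cong refl, subst sum_alternating_nonempty_subsets)
      (auto simp: sources_def intro: finite_subset)
  also have "\<dots> = (\<Sum>D\<in>?O. \<Sum>S | S \<in> ?M \<and> S \<subseteq> sources V D. (-1) ^ (card S + 1))"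
    using monochromatic_sources
    by (intro sum.cong refl) (auto simp: sources_def)
  also have "\<dots> = (\<Sum>S\<in>?M. \<Sum>D | D \<in> ?O \<and> S \<subseteq> sources V D. (-1) ^ (card S + 1))"
    by (rule sum.swap_restrict[OF fin])
  also have "\<dots> = (\<Sum>S\<in>?M. (-1) ^ (card S + 1) * of_nat (card (acyclic_orientations c (V - S))))"
    using assms by (intro sum.cong refl)
      (simp add: card_orientations_with_sources mult.commute)
  finally show ?thesis .
qed

text \<open>A nonempty monochromatic set determines its colour, so the sum splits over the parts;
  the empty set would be counted once per part.\<close>

lemma sum_nonempty_monochromatic:
  assumes "finite V" "\<And>v. v \<in> V \<Longrightarrow> c v < p"
  shows "(\<Sum>S | S \<subseteq> V \<and> S \<noteq> {} \<and> monochromatic c S. f S) =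
         (\<Sum>i<p. \<Sum>S | S \<subseteq> {v \<in> V. c v = i} \<and> S \<noteq> {}. f S)"
proof -
  have "{S. S \<subseteq> V \<and> S \<noteq> {} \<and> monochromatic c S} =
        (\<Union>i<p. {S. S \<subseteq> {v \<in> V. c v = i} \<and> S \<noteq> {}})" (is "?M = ?U")
  proof (intro equalityI subsetI)
    fix S assume "S \<in> ?M"
    then have S: "S \<subseteq> V" "S \<noteq> {}" "monochromatic c S"
      by auto
    then obtain x where "x \<in> S"
      by blast
    then have "c x < p"
      using S(1) assms(2) by blast
    moreover have "S \<subseteq> {v \<in> V. c v = c x}"
      using S(1,3) \<open>x \<in> S\<close> unfolding monochromatic_def by blast
    ultimately show "S \<in> ?U"
      using S(2) by blast
  next
    fix S assume "S \<in> ?U"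
    then show "S \<in> ?M"
      unfolding monochromatic_def by blast
  qed
  moreover have "sum f ?U = (\<Sum>i<p. sum f {S. S \<subseteq> {v \<in> V. c v = i} \<and> S \<noteq> {}})"
  proof (rule sum.UNION_disjoint)
    show "\<forall>i\<in>{..<p}. finite {S. S \<subseteq> {v \<in> V. c v = i} \<and> S \<noteq> {}}"
      using assms(1) by simp
    show "\<forall>i\<in>{..<p}. \<forall>j\<in>{..<p}. i \<noteq> j \<longrightarrow>
      {S. S \<subseteq> {v \<in> V. c v = i} \<and> S \<noteq> {}} \<inter> {S. S \<subseteq> {v \<in> V. c v = j} \<and> S \<noteq> {}} = {}"
      by blast
  qed simp
  ultimately show ?thesis
    by simp
qed

lemma sum_nonempty_subsets_card:
  assumes "finite X"
  shows "(\<Sum>S | S \<subseteq> X \<and> S \<noteq> {}. f (card S)) =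
         (\<Sum>k = 1..card X. of_nat (card X choose k) * f k :: 'b :: comm_ring_1)"
proof -
  let ?A = "{S. S \<subseteq> X \<and> S \<noteq> {}}"
  have "(\<Sum>S\<in>?A. f (card S)) = (\<Sum>k = 1..card X. \<Sum>S | S \<in> ?A \<and> card S = k. f (card S))"
    using assms by (intro sum.group[symmetric])
      (auto simp: Suc_le_eq card_gt_0_iff card_mono dest: finite_subset)
  also have "\<dots> = (\<Sum>k = 1..card X. of_nat (card X choose k) * f k)"
  proof (intro sum.cong refl)
    fix k assume "k \<in> {1..card X}"
    then have "{S. S \<in> ?A \<and> card S = k} = {S. S \<subseteq> X \<and> card S = k}"
      by auto
    then show "(\<Sum>S | S \<in> ?A \<and> card S = k. f (card S)) = of_nat (card X choose k) * f k"
      using assms by (simp add: n_subsets)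
  qed
  finally show ?thesis .
qed

section \<open>Integral representation\<close>

definition fps_one_minus_exp_neg :: "complex fps" where
  "fps_one_minus_exp_neg = 1 - fps_exp (-1)"

text \<open>This is \<open>n!\<close> times the coefficient of \<open>x ^ n\<close> in
  \<open>exp (t * (1 - exp (- x)))\<close>, as a polynomial in \<open>t\<close>. In terms of the
  Touchard polynomials \<open>T n\<close> it is \<open>(-1) ^ n * T n (- t)\<close>, so its
  coefficients are Stirling numbers of the second kind with alternating signs. Stopping at
  \<open>k = n\<close> loses nothing, because the \<open>k\<close>-th power of the inner series
  starts at \<open>x ^ k\<close>.\<close>

definition signed_touchard :: "nat \<Rightarrow> complex poly" where
  "signed_touchard n = (\<Sum>k\<le>n. monom (fact n / fact k * fps_nth (fps_one_minus_exp_neg ^ k) n) k)"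

lemma fps_one_minus_exp_neg_nth: "fps_nth fps_one_minus_exp_neg j = (if j = 0 then 0 else (-1) ^ (j + 1) / fact j)"
  by (simp add: fps_one_minus_exp_neg_def)

lemma fps_one_minus_exp_neg_power_nth_eq_0: "n < k \<Longrightarrow> fps_nth (fps_one_minus_exp_neg ^ k) n = 0"
  using startsby_zero_power_prefix[of fps_one_minus_exp_neg k] by (simp add: fps_one_minus_exp_neg_nth)

lemma coeff_signed_touchard: "coeff (signed_touchard n) k = fact n / fact k * fps_nth (fps_one_minus_exp_neg ^ k) n"
proof -
  have "coeff (signed_touchard n) k = (\<Sum>j\<le>n. if j = k then fact n / fact j * fps_nth (fps_one_minus_exp_neg ^ j) n else 0)"
    by (simp add: signed_touchard_def coeff_sum)
  then show ?thesis
    by (simp add: fps_one_minus_exp_neg_power_nth_eq_0)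
qed

lemma poly_signed_touchard: "poly (signed_touchard n) t = fact n * (\<Sum>k\<le>n. t ^ k / fact k * fps_nth (fps_one_minus_exp_neg ^ k) n)"
  by (simp add: signed_touchard_def poly_sum poly_monom sum_distrib_left algebra_simps)

lemma signed_touchard_0: "signed_touchard 0 = 1"
  by (simp add: signed_touchard_def)

lemma poly_signed_touchard_0: "n > 0 \<Longrightarrow> poly (signed_touchard n) 0 = 0"
  by (simp add: poly_0_coeff_0 coeff_signed_touchard)

text \<open>Differentiating the generating function in \<open>t\<close> multiplies it by
  \<open>1 - exp (- x)\<close>, which is a signed binomial convolution on coefficients. These are
  the signs and weights that appear when \<open>j\<close> vertices are removed from a part of size
  \<open>n\<close>.\<close>

lemma pderiv_signed_touchard:
  "pderiv (signed_touchard n) = (\<Sum>j = 1..n. smult (of_nat (n choose j) * (-1) ^ (j + 1)) (signed_touchard (n - j)))"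
proof (rule poly_eqI)
  fix k
  have "coeff (pderiv (signed_touchard n)) k = fact n / fact k * fps_nth (fps_one_minus_exp_neg * fps_one_minus_exp_neg ^ k) n"
    by (simp add: coeff_pderiv coeff_signed_touchard fact_Suc del: of_nat_Suc)
  also have "\<dots> = (\<Sum>j = 0..n. fact n / fact k * (fps_nth fps_one_minus_exp_neg j * fps_nth (fps_one_minus_exp_neg ^ k) (n - j)))"
    by (simp only: fps_mult_nth sum_distrib_left)
  also have "\<dots> = (\<Sum>j = 1..n. fact n / fact k * (fps_nth fps_one_minus_exp_neg j * fps_nth (fps_one_minus_exp_neg ^ k) (n - j)))"
    by (intro sum.mono_neutral_right) (auto simp: fps_one_minus_exp_neg_nth)
  also have "\<dots> = (\<Sum>j = 1..n. of_nat (n choose j) * (-1) ^ (j + 1) * coeff (signed_touchard (n - j)) k)"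
    by (intro sum.cong refl) (simp add: fps_one_minus_exp_neg_nth coeff_signed_touchard binomial_fact field_simps)
  also have "\<dots> = coeff (\<Sum>j = 1..n. smult (of_nat (n choose j) * (-1) ^ (j + 1)) (signed_touchard (n - j))) k"
    by (simp add: coeff_sum)
  finally show "coeff (pderiv (signed_touchard n)) k = \<dots>" .
qed

lemma pderiv_signed_touchard_card:
  assumes "finite X"
  shows "pderiv (signed_touchard (card X)) =
    (\<Sum>S | S \<subseteq> X \<and> S \<noteq> {}. smult ((-1) ^ (card S + 1)) (signed_touchard (card X - card S)))"
  using sum_nonempty_subsets_card[OF assms, of "\<lambda>k. smult ((-1) ^ (k + 1)) (signed_touchard (card X - k))"]
  by (simp add: pderiv_signed_touchard of_nat_poly mult.commute)

text \<open>The integral of \<open>exp (- t) * P t\<close> over the positive axis, encoded by its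
  values \<open>k!\<close> on monomials. The combinatorial induction thus stays algebraic.\<close>

definition laplace :: "complex poly \<Rightarrow> complex" where
  "laplace P = (\<Sum>k\<le>degree P. fact k * coeff P k)"

lemma laplace_eq:
  assumes "degree P \<le> n"
  shows "laplace P = (\<Sum>k\<le>n. fact k * coeff P k)"
  unfolding laplace_def using assms
  by (intro sum.mono_neutral_left) (auto intro!: coeff_eq_0)

lemma laplace_0 [simp]: "laplace 0 = 0"
  by (simp add: laplace_def)

lemma laplace_add: "laplace (P + Q) = laplace P + laplace Q"
proof -
  let ?n = "max (degree P) (degree Q)"
  have "laplace (P + Q) = (\<Sum>k\<le>?n. fact k * coeff (P + Q) k)"
    by (rule laplace_eq) (rule degree_add_le_max)
  moreover have "laplace P = (\<Sum>k\<le>?n. fact k * coeff P k)"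
    by (rule laplace_eq) simp
  moreover have "laplace Q = (\<Sum>k\<le>?n. fact k * coeff Q k)"
    by (rule laplace_eq) simp
  ultimately show ?thesis
    by (simp add: sum.distrib algebra_simps)
qed

lemma laplace_smult: "laplace (smult a P) = a * laplace P"
proof -
  have "laplace (smult a P) = (\<Sum>k\<le>degree P. fact k * coeff (smult a P) k)"
    by (rule laplace_eq) (rule degree_smult_le)
  then show ?thesis
    by (simp add: laplace_def sum_distrib_left algebra_simps)
qed

lemma laplace_sum: "laplace (\<Sum>x\<in>A. f x) = (\<Sum>x\<in>A. laplace (f x))"
  by (induction A rule: infinite_finite_induct) (simp_all add: laplace_add)

text \<open>Integration by parts against \<open>exp (- t)\<close>, with boundary term
  \<open>poly P 0\<close>.\<close>

lemma laplace_pderiv: "laplace (pderiv P) = laplace P - poly P 0"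
proof -
  have "laplace P = (\<Sum>k\<le>Suc (degree P). fact k * coeff P k)"
    by (rule laplace_eq) simp
  also have "\<dots> = poly P 0 + (\<Sum>k\<le>degree P. fact k * coeff (pderiv P) k)"
    by (subst sum.atMost_Suc_shift) (simp add: coeff_pderiv poly_0_coeff_0 algebra_simps)
  also have "(\<Sum>k\<le>degree P. fact k * coeff (pderiv P) k) = laplace (pderiv P)"
    by (rule laplace_eq[symmetric]) (simp add: degree_pderiv)
  finally show ?thesis
    by simp
qed

lemma has_bochner_integral_laplace:
  "has_bochner_integral lborel (\<lambda>t. indicator {0..} t *\<^sub>R (exp (- complex_of_real t) * poly P (of_real t)))
     (laplace P)"
proof -
  have mono: "has_bochner_integral lborel (\<lambda>t. t ^ k * exp (- t) * indicator {0..} t :: real) (fact k)" for k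
    using nn_intergal_power_times_exp_Ici[of k]
    by (intro has_bochner_integral_nn_integral)
      (auto simp: indicator_mult_ennreal mult.commute intro!: AE_I2 split: split_indicator)
  have "has_bochner_integral lborel
          (\<lambda>t. \<Sum>k\<le>degree P. coeff P k * of_real (t ^ k * exp (- t) * indicator {0..} t))
          (\<Sum>k\<le>degree P. coeff P k * of_real (fact k))"
    by (intro has_bochner_integral_sum has_bochner_integral_mult_right
        has_bochner_integral_of_real mono)
  moreover have "(\<lambda>t. \<Sum>k\<le>degree P. coeff P k * of_real (t ^ k * exp (- t) * indicator {0..} t)) =
        (\<lambda>t. indicator {0..} t *\<^sub>R (exp (- complex_of_real t) * poly P (of_real t)))"
    by (rule ext)
      (simp add: poly_altdef sum_distrib_left indicator_def algebra_simps exp_of_real[symmetric] exp_minus)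
  ultimately show ?thesis
    by (simp add: laplace_def mult.commute)
qed

text \<open>For the product \<open>Q\<close> of the part polynomials, the product rule turns the
  derivative into a sum over parts, and within a part into a signed sum over its nonempty subsets.
  By the induction hypothesis the recurrence for the count then has right-hand side
  \<open>laplace (pderiv Q)\<close>, which equals \<open>laplace Q\<close> as soon as
  \<open>Q\<close> vanishes at 0.\<close>

lemma card_acyclic_orientations:
  assumes "finite V" "\<And>v. v \<in> V \<Longrightarrow> c v < p"
  shows "of_nat (card (acyclic_orientations c V)) =
    laplace (\<Prod>i<p. signed_touchard (card {v \<in> V. c v = i}))"
  using assms
proof (induction rule: finite_psubset_induct)
  case (psubset V)
  show ?case
  proof (cases "V = {}")
    case True
    have "acyclic_orientations c {} = {{}}"
      by (auto simp: acyclic_orientations_def multipartite_arcs_def acyclic_def)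
    then show ?thesis
      by (simp add: True signed_touchard_0 laplace_def)
  next
    case False
    define X where "X = (\<lambda>i. {v \<in> V. c v = i})"
    define Q where "Q = (\<Prod>i<p. signed_touchard (card (X i)))"
    have finX: "finite (X i)" for i
      using psubset.hyps by (simp add: X_def)
    have Q_rec: "(\<Prod>j<p. signed_touchard (card {v \<in> V - S. c v = j})) =
        (\<Prod>j\<in>{..<p} - {i}. signed_touchard (card (X j))) * signed_touchard (card (X i) - card S)"
      if "i < p" "S \<subseteq> X i" for i S
    proof -
      have "{v \<in> V - S. c v = i} = X i - S"
        by (auto simp: X_def)
      moreover have "finite S"
        using that finX finite_subset by blast
      moreover have "{v \<in> V - S. c v = j} = X j" if "j \<noteq> i" for j
        using that \<open>S \<subseteq> X i\<close> by (auto simp: X_def)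
      ultimately show ?thesis
        using that by (subst prod.remove[of _ i]) (auto simp: card_Diff_subset intro!: prod.cong)
    qed
    have "of_nat (card (acyclic_orientations c V)) =
      (\<Sum>i<p. \<Sum>S | S \<subseteq> X i \<and> S \<noteq> {}.
         (-1) ^ (card S + 1) * of_nat (card (acyclic_orientations c (V - S))) :: complex)"
      using psubset.hyps psubset.prems False unfolding X_def
      by (subst card_acyclic_orientations_rec) (simp_all add: sum_nonempty_monochromatic)
    also have "\<dots> = (\<Sum>i<p. \<Sum>S | S \<subseteq> X i \<and> S \<noteq> {}.
        laplace ((\<Prod>j\<in>{..<p} - {i}. signed_touchard (card (X j))) *
          smult ((-1) ^ (card S + 1)) (signed_touchard (card (X i) - card S))))"
    proof (intro sum.cong refl)
      fix i S assume i: "i \<in> {..<p}" and S: "S \<in> {S. S \<subseteq> X i \<and> S \<noteq> {}}"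
      have "V - S \<subset> V"
        using S by (auto simp: X_def)
      then have "of_nat (card (acyclic_orientations c (V - S))) =
          laplace (\<Prod>j<p. signed_touchard (card {v \<in> V - S. c v = j}))"
        using psubset.prems by (intro psubset.IH) auto
      then show "(-1) ^ (card S + 1) * of_nat (card (acyclic_orientations c (V - S))) =
          laplace ((\<Prod>j\<in>{..<p} - {i}. signed_touchard (card (X j))) *
          smult ((-1) ^ (card S + 1)) (signed_touchard (card (X i) - card S)))"
        using i S Q_rec[of i S] by (simp add: laplace_smult del: power_Suc)
    qed
    also have "\<dots> = (\<Sum>i<p. laplace ((\<Prod>j\<in>{..<p} - {i}. signed_touchard (card (X j))) * pderiv (signed_touchard (card (X i)))))"
      by (intro sum.cong refl) (simp add: laplace_sum[symmetric] sum_distrib_left sum_negf pderiv_signed_touchard_card finX)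
    also have "\<dots> = laplace (pderiv Q)"
      by (simp add: Q_def pderiv_prod laplace_sum)
    also have "\<dots> = laplace Q - poly Q 0"
      by (rule laplace_pderiv)
    \<comment> \<open>Some part is nonempty, and its factor vanishes at 0. Empty parts contribute
      the constant factor 1 and do no harm.\<close>
    also have "poly Q 0 = 0"
    proof -
      obtain v where "v \<in> V"
        using False by blast
      then have "card (X (c v)) > 0"
        using finX[of "c v"] by (auto simp: X_def card_gt_0_iff)
      then show ?thesis
        using psubset.prems[OF \<open>v \<in> V\<close>]
        by (auto simp: Q_def poly_prod poly_signed_touchard_0 intro!: prod_zero bexI[of _ "c v"])
    qed
    finally show ?thesis
      by (simp add: Q_def X_def)
  qed
qed

section \<open>Saddle point asymptotics\<close>

lemma x_cos_le_sin:
  fixes x :: real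
  assumes "0 \<le> x" "x \<le> pi"
  shows "x * cos x \<le> sin x"
proof -
  have "sin 0 - 0 * cos 0 \<le> sin x - x * cos x"
  proof (rule DERIV_nonneg_imp_nondecreasing[OF assms(1)])
    fix y assume "0 \<le> y" "y \<le> x"
    then show "\<exists>d. ((\<lambda>x. sin x - x * cos x) has_real_derivative d) (at y) \<and> 0 \<le> d"
      using assms(2) by (intro exI[of _ "y * sin y"] conjI)
        (auto intro!: derivative_eq_intros mult_nonneg_nonneg sin_ge_zero)
  qed
  then show ?thesis
    by simp
qed

text \<open>A weak Jordan inequality from \<open>sin x = 2 * sin (x / 2) * cos (x / 2)\<close>:
  bound \<open>sin (x / 2)\<close> below by \<open>x / 2 * cos (x / 2)\<close> and use
  \<open>2 * (cos (x / 2))\<^sup>2 = 1 + cos x \<ge> 1\<close>.\<close>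

lemma sin_ge_half:
  fixes x :: real
  assumes "0 \<le> x" "x \<le> pi / 2"
  shows "x / 2 \<le> sin x"
proof -
  have cos: "cos (x / 2) \<ge> 0" "cos x \<ge> 0"
    using assms by (auto intro!: cos_ge_zero)
  have "x / 2 \<le> x * (1 + cos x) / 2"
    using assms cos mult_left_mono[of 1 "1 + cos x" x] by simp
  also have "1 + cos x = 2 * (cos (x / 2))\<^sup>2"
    using cos_double_cos[of "x / 2"] by simp
  also have "x * (2 * (cos (x / 2))\<^sup>2) / 2 = 2 * (x / 2 * cos (x / 2)) * cos (x / 2)"
    by (simp add: power2_eq_square)
  also have "\<dots> \<le> 2 * sin (x / 2) * cos (x / 2)"
    using x_cos_le_sin[of "x / 2"] assms cos by (intro mult_right_mono mult_left_mono) auto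
  also have "\<dots> = sin x"
    using sin_double[of "x / 2"] by simp
  finally show ?thesis .
qed

lemma one_minus_cos_ge:
  fixes x :: real
  assumes "\<bar>x\<bar> \<le> pi"
  shows "x\<^sup>2 / 8 \<le> 1 - cos x"
proof -
  have "(\<bar>x\<bar> / 2 / 2)\<^sup>2 \<le> (sin (\<bar>x\<bar> / 2))\<^sup>2"
    using assms by (intro power_mono sin_ge_half) auto
  moreover have "cos x = 1 - 2 * (sin (\<bar>x\<bar> / 2))\<^sup>2"
    using cos_double_sin[of "\<bar>x\<bar> / 2"] by simp
  ultimately show ?thesis
    by (simp add: power_divide)
qed

text \<open>The right-hand side is the real part of \<open>exp (- z)\<close> at
  \<open>z = r * cis \<theta>\<close>. Its derivative in the angle is a positive multiple of
  \<open>sin (\<theta> - r * sin \<theta>)\<close>, and for \<open>r < 1\<close> this argument stays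
  in \<open>{0..pi}\<close> and is at least \<open>(1 - r) * \<theta>\<close> for nonnegative
  angles. So the minimum on the circle is at angle 0, with quadratic growth.\<close>

lemma Re_exp_neg_cis_ge:
  assumes "0 < r" "r < 1" "\<bar>\<theta>\<bar> \<le> pi"
  shows "exp (- r) + r * exp (- r) * (1 - r) / 16 * \<theta>\<^sup>2 \<le> exp (- (r * cos \<theta>)) * cos (r * sin \<theta>)"
proof -
  define k where "k = r * exp (- r) * (1 - r)"
  define h where "h = (\<lambda>x. exp (- (r * cos x)) * cos (r * sin x))"
  have k: "k \<ge> 0"
    using assms by (simp add: k_def)
  have deriv: "(h has_real_derivative r * exp (- (r * cos x)) * sin (x - r * sin x)) (at x)" for x
    unfolding h_def
    by (rule derivative_eq_intros refl)+ (simp add: sin_diff algebra_simps)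
  have sin_le: "0 \<le> sin x" "sin x \<le> x" if "0 \<le> x" "x \<le> pi" for x :: real
    using that sin_x_le_x sin_ge_zero by auto
  have nonneg: "0 \<le> x - r * sin x \<and> x - r * sin x \<le> pi" if "0 \<le> x" "x \<le> pi" for x
  proof -
    have "r * sin x \<le> 1 * sin x"
      using assms sin_le[OF that] by (intro mult_right_mono) auto
    moreover have "0 \<le> r * sin x"
      using assms sin_le[OF that] by simp
    ultimately show ?thesis
      using sin_le[OF that] that by simp
  qed
  have deriv_ge: "r * exp (- (r * cos x)) * sin (x - r * sin x) \<ge> k * x / 2"
    if "0 \<le> x" "x \<le> pi / 2" for x
  proof -
    have lower: "(1 - r) * x \<le> x - r * sin x"
      using assms sin_le[of x] that by (simp add: algebra_simps)
    moreover have "0 \<le> (1 - r) * x"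
      using assms that by simp
    ultimately have "0 \<le> x - r * sin x"
      by (rule order_trans[rotated])
    moreover have "0 \<le> r * sin x"
      using assms sin_le(1)[of x] that by (intro mult_nonneg_nonneg) auto
    ultimately have "(x - r * sin x) / 2 \<le> sin (x - r * sin x)"
      using that by (intro sin_ge_half) auto
    then have "(1 - r) * x / 2 \<le> sin (x - r * sin x)"
      using lower by argo
    moreover have "r * exp (- r) \<le> r * exp (- (r * cos x))"
      using assms by simp
    ultimately have "r * exp (- r) * ((1 - r) * x / 2) \<le> r * exp (- (r * cos x)) * sin (x - r * sin x)"
      using assms that by (intro mult_mono) auto
    then show ?thesis
      by (simp add: k_def algebra_simps)
  qed
  \<comment> \<open>The growth constant is \<open>k / 4\<close>: the derivative is at least
    \<open>k * x / 2\<close>, where the half stems from \<open>sin_ge_half\<close>.\<close>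
  have quad: "exp (- r) + k / 4 * x\<^sup>2 \<le> h x" if "0 \<le> x" "x \<le> pi / 2" for x
  proof -
    have "h 0 - k / 4 * 0\<^sup>2 \<le> h x - k / 4 * x\<^sup>2"
    proof (rule DERIV_nonneg_imp_nondecreasing[OF that(1)])
      fix y assume "0 \<le> y" "y \<le> x"
      then show "\<exists>d. ((\<lambda>x. h x - k / 4 * x\<^sup>2) has_real_derivative d) (at y) \<and> 0 \<le> d"
        using deriv_ge[of y] that(2)
        by (intro exI[of _ "r * exp (- (r * cos y)) * sin (y - r * sin y) - k * y / 2"] conjI)
          (auto intro!: derivative_eq_intros deriv)
    qed
    then show ?thesis
      by (simp add: h_def)
  qed
  have main: "exp (- r) + k / 16 * x\<^sup>2 \<le> h x" if "0 \<le> x" "x \<le> pi" for x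
  proof (cases "x \<le> pi / 2")
    case True
    have "k / 16 * x\<^sup>2 \<le> k / 4 * x\<^sup>2"
      using k by (intro mult_right_mono) auto
    then show ?thesis
      using quad[of x] True that by linarith
  next
    case False
    \<comment> \<open>Beyond \<open>pi / 2\<close> only monotonicity is used. The gain
      \<open>k / 4 * (pi / 2)\<^sup>2\<close> already made equals
      \<open>k / 16 * pi\<^sup>2\<close>, whence the 16 in the statement.\<close>
    have "h (pi / 2) \<le> h x"
    proof (rule DERIV_nonneg_imp_nondecreasing[of "pi / 2" x h])
      fix y assume "pi / 2 \<le> y" "y \<le> x"
      then have "0 \<le> r * exp (- (r * cos y)) * sin (y - r * sin y)"
        using assms nonneg[of y] that pi_gt_zero by (intro mult_nonneg_nonneg sin_ge_zero) auto
      then show "\<exists>d. (h has_real_derivative d) (at y) \<and> 0 \<le> d"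
        using deriv by blast
    qed (use False in simp)
    moreover have "exp (- r) + k / 4 * (pi / 2)\<^sup>2 \<le> h (pi / 2)"
      by (rule quad) auto
    moreover have "k / 16 * x\<^sup>2 \<le> k / 16 * pi\<^sup>2"
      using k that by (intro mult_left_mono power_mono) auto
    ultimately show ?thesis
      by (simp add: power2_eq_square)
  qed
  have "h \<theta> = h \<bar>\<theta>\<bar>"
    by (auto simp: h_def abs_if)
  then show ?thesis
    using main[of "\<bar>\<theta>\<bar>"] assms(3) by (simp add: h_def k_def)
qed

section \<open>Gaussian integrals and the saddle point lemma\<close>

lemma gaussian_integral:
  assumes "k > 0"
  shows "has_bochner_integral lborel (\<lambda>x. exp (- k * x\<^sup>2)) (sqrt (pi / k))"
proof -
  define \<sigma> where "\<sigma> = sqrt (1 / (2 * k))"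
  have \<sigma>: "\<sigma>\<^sup>2 = 1 / (2 * k)" "\<sigma> > 0"
    using assms by (auto simp: \<sigma>_def)
  have "(\<lambda>x. exp (- k * x\<^sup>2)) = (\<lambda>x. sqrt (pi / k) * normal_density 0 \<sigma> x)"
    using assms by (auto simp: normal_density_def \<sigma> fun_eq_iff field_simps)
  moreover have "has_bochner_integral lborel (normal_density 0 \<sigma>) 1"
    using \<sigma> by (simp add: has_bochner_integral_iff)
  ultimately show ?thesis
    using has_bochner_integral_mult_right[of "sqrt (pi / k)" lborel "normal_density 0 \<sigma>" 1] assms
    by auto
qed

text \<open>This is the characteristic function of the standard normal law after the substitution
  \<open>x = s * u\<close> with \<open>s\<^sup>2 = 2 * k\<close>.\<close>

lemma gaussian_fourier:
  assumes "k > 0"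
  shows "(LINT u|lborel. exp (\<i> * of_real y * of_real u - of_real k * (of_real u)\<^sup>2)) =
    complex_of_real (sqrt (pi / k) * exp (- y\<^sup>2 / (4 * k)))"
proof -
  define I where "I = (LINT u|lborel. exp (\<i> * of_real y * of_real u - of_real k * (of_real u)\<^sup>2))"
  define s where "s = sqrt (2 * k)"
  have s: "s > 0" "s\<^sup>2 = 2 * k"
    using assms by (auto simp: s_def)
  have "complex_of_real (exp (- (y / s)\<^sup>2 / 2)) = char std_normal_distribution (y / s)"
    by (simp add: char_std_normal_distribution)
  also have "\<dots> = (LINT x|lborel. std_normal_density x *\<^sub>R iexp (y / s * x))"
    unfolding char_def by (subst integral_density) auto
  also have "\<dots> = s *\<^sub>R (LINT u|lborel. std_normal_density (s * u) *\<^sub>R iexp (y / s * (s * u)))"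
    using s by (subst lborel_integral_real_affine[where c = s and t = 0]) auto
  also have "(\<lambda>u. std_normal_density (s * u) *\<^sub>R iexp (y / s * (s * u))) =
      (\<lambda>u. of_real (1 / sqrt (2 * pi)) * exp (\<i> * of_real y * of_real u - of_real k * (of_real u)\<^sup>2))"
  proof
    fix u
    have "- (s * u)\<^sup>2 / 2 = - (k * u\<^sup>2)"
      using s by (simp add: power_mult_distrib)
    then show "std_normal_density (s * u) *\<^sub>R iexp (y / s * (s * u)) =
      of_real (1 / sqrt (2 * pi)) * exp (\<i> * of_real y * of_real u - of_real k * (of_real u)\<^sup>2)"
      using s by (simp add: std_normal_density_def scaleR_conv_of_real exp_diff exp_minus field_simps
          flip: exp_of_real)
  qed
  finally have "complex_of_real (exp (- (y / s)\<^sup>2 / 2)) = of_real (s / sqrt (2 * pi)) * I"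
    by (simp add: scaleR_conv_of_real I_def)
  moreover have "s / sqrt (2 * pi) = 1 / sqrt (pi / k)"
    using assms by (simp add: s_def real_sqrt_divide real_sqrt_mult field_simps)
  moreover have "- (y / s)\<^sup>2 / 2 = - y\<^sup>2 / (4 * k)"
    using s by (simp add: power_divide)
  ultimately have "complex_of_real (exp (- y\<^sup>2 / (4 * k))) = of_real (1 / sqrt (pi / k)) * I"
    by simp
  then show ?thesis
    using assms by (simp add: field_simps I_def)
qed

text \<open>Substituting \<open>\<theta> = u / sqrt (m N)\<close> makes the exponent converge to
  \<open>\<i> * y * u - \<tau> * b / 2 * u\<^sup>2\<close>, whose integral is a Gaussian Fourier
  transform. The exact curvature \<open>b\<close> at 0 determines the limit; the possibly much
  smaller \<open>c\<close> only supplies a majorant on the whole circle. The offset \<open>y\<close>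
  measures, in units of \<open>sqrt (m N)\<close>, how far the frequency \<open>\<nu> N\<close> is
  from the centre \<open>a * t N\<close>.\<close>

lemma saddle_point:
  fixes g :: "real \<Rightarrow> complex" and t m \<nu> :: "nat \<Rightarrow> real" and a b c \<tau> y :: real
  assumes cont: "continuous_on UNIV g"
    and expand: "((\<lambda>\<theta>. (g \<theta> - \<i> * of_real (a * \<theta>)) / of_real (\<theta>\<^sup>2)) \<longlongrightarrow> - of_real b / 2) (at 0)"
    and decay: "\<And>\<theta>. \<bar>\<theta>\<bar> \<le> pi \<Longrightarrow> Re (g \<theta>) \<le> - c * \<theta>\<^sup>2"
    and pos: "b > 0" "c > 0" "\<tau> > 0"
    and m: "filterlim m at_top sequentially"
    and t: "(\<lambda>N. t N / m N) \<longlonglongrightarrow> \<tau>"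
    and y: "(\<lambda>N. (a * t N - \<nu> N) / sqrt (m N)) \<longlonglongrightarrow> y"
  shows "(\<lambda>N. of_real (sqrt (m N)) *
            (LINT \<theta>:{-pi..pi}|lborel. exp (of_real (t N) * g \<theta> - \<i> * of_real (\<nu> N * \<theta>))))
         \<longlonglongrightarrow> complex_of_real (sqrt (2 * pi / (\<tau> * b)) * exp (- y\<^sup>2 / (2 * \<tau> * b)))"
proof -
  define F where "F = (\<lambda>N \<theta>. exp (of_real (t N) * g \<theta> - \<i> * of_real (\<nu> N * \<theta>)))"
  define s where "s = (\<lambda>N u. indicator {-pi..pi} (u / sqrt (m N)) *\<^sub>R F N (u / sqrt (m N)))"
  define k where "k = \<tau> * b / 2"
  have k: "k > 0"
    using pos by (simp add: k_def)
  have m_pos: "eventually (\<lambda>N. m N > 0) sequentially"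
    using m by (simp add: filterlim_at_top_dense)
  have contF: "continuous_on UNIV (F N)" for N
    unfolding F_def by (intro continuous_intros cont)
  have meas: "(\<lambda>u. s N u) \<in> borel_measurable lborel" for N
  proof -
    have [measurable]: "F N \<in> borel_measurable borel"
      by (rule borel_measurable_continuous_onI[OF contF])
    show ?thesis
      unfolding s_def by measurable
  qed
  have scale: "eventually (\<lambda>N. of_real (sqrt (m N)) * (LINT \<theta>:{-pi..pi}|lborel. F N \<theta>) =
      (LINT u|lborel. s N u)) sequentially"
    using m_pos
  proof eventually_elim
    case (elim N)
    have "(LINT \<theta>:{-pi..pi}|lborel. F N \<theta>) =
        \<bar>1 / sqrt (m N)\<bar> *\<^sub>R (LINT u|lborel. s N u)"
      unfolding set_lebesgue_integral_def s_def using elim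
      by (subst lborel_integral_real_affine[where c = "1 / sqrt (m N)" and t = 0]) auto
    then show ?case
      using elim by (simp add: scaleR_conv_of_real)
  qed
  have "(\<lambda>N. LINT u|lborel. s N u) \<longlonglongrightarrow>
      (LINT u|lborel. exp (\<i> * of_real y * of_real u - of_real k * (of_real u)\<^sup>2))"
  proof -
    define w where "w = (\<lambda>u. exp (- (\<tau> / 2 * c) * u\<^sup>2))"
    \<comment> \<open>Half of the limit \<open>\<tau>\<close> is an eventual lower bound for
      \<open>t N / m N\<close>; it makes the majorant \<open>w\<close> independent of
      \<open>N\<close>.\<close>
    have "eventually (\<lambda>N. t N / m N > \<tau> / 2) sequentially"
      using t pos by (intro order_tendstoD) auto
    with m_pos have "eventually (\<lambda>N. \<forall>u. norm (s N u) \<le> w u) sequentially"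
    proof eventually_elim
      case (elim N)
      show ?case
      proof
        fix u
        define \<theta> where "\<theta> = u / sqrt (m N)"
        show "norm (s N u) \<le> w u"
        proof (cases "\<theta> \<in> {-pi..pi}")
          case True
          have tN: "t N > 0"
            using elim pos by (smt (verit) divide_nonpos_pos half_gt_zero)
          have "Re (of_real (t N) * g \<theta> - \<i> * of_real (\<nu> N * \<theta>)) = t N * Re (g \<theta>)"
            by simp
          also have "\<dots> \<le> t N * (- c * \<theta>\<^sup>2)"
            using tN True decay by (intro mult_left_mono) auto
          also have "\<dots> = - (t N / m N * c * u\<^sup>2)"
            using elim by (simp add: \<theta>_def power_divide)
          also have "\<dots> \<le> - (\<tau> / 2 * c * u\<^sup>2)"
            using elim pos mult_right_mono[of "\<tau> / 2" "t N / m N" "c * u\<^sup>2"] by (simp add: mult.assoc)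
          finally show ?thesis
            using True by (simp add: s_def F_def w_def flip: \<theta>_def)
        next
          case False
          then show ?thesis
            by (simp add: s_def w_def flip: \<theta>_def)
        qed
      qed
    qed
    then obtain N0 where N0: "norm (s N u) \<le> w u" if "N \<ge> N0" for N u
      unfolding eventually_sequentially by blast
    \<comment> \<open>At \<open>u = 0\<close> the angle is 0 and the difference quotient in
      \<open>expand\<close> says nothing; this single point is a null set.\<close>
    have lim: "(\<lambda>N. s N u) \<longlonglongrightarrow> exp (\<i> * of_real y * of_real u - of_real k * (of_real u)\<^sup>2)"
      if "u \<noteq> 0" for u
    proof -
      define \<theta> where "\<theta> = (\<lambda>N. u / sqrt (m N))"
      have \<theta>0: "\<theta> \<longlonglongrightarrow> 0"
        unfolding \<theta>_def
        by (intro tendsto_divide_0[OF tendsto_const] filterlim_at_top_imp_at_infinity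
            filterlim_compose[OF sqrt_at_top m])
      moreover have \<theta>_nz: "eventually (\<lambda>N. \<theta> N \<noteq> 0) sequentially"
        using m_pos by eventually_elim (use that in \<open>simp add: \<theta>_def\<close>)
      ultimately have \<theta>: "filterlim \<theta> (at 0) sequentially"
        by (simp add: filterlim_at)
      \<comment> \<open>The exponent is split into the quadratic quotient of \<open>g\<close> and
        the linear remainder \<open>(a * t N - \<nu> N) * \<theta>\<close>, so that each piece has a
        limit by hypothesis.\<close>
      have "(\<lambda>N. of_real (t N / m N) * of_real (u\<^sup>2) *
              ((g (\<theta> N) - \<i> * of_real (a * \<theta> N)) / of_real ((\<theta> N)\<^sup>2)) +
              \<i> * of_real ((a * t N - \<nu> N) / sqrt (m N)) * of_real u)
            \<longlonglongrightarrow> of_real \<tau> * of_real (u\<^sup>2) * (- of_real b / 2) + \<i> * of_real y * of_real u"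
        by (intro tendsto_intros t y filterlim_compose[OF expand \<theta>])
      also have "of_real \<tau> * of_real (u\<^sup>2) * (- of_real b / 2) + \<i> * of_real y * of_real u =
          \<i> * of_real y * of_real u - of_real k * (of_real u)\<^sup>2"
        by (simp add: k_def algebra_simps)
      finally have "(\<lambda>N. exp (of_real (t N / m N) * of_real (u\<^sup>2) *
              ((g (\<theta> N) - \<i> * of_real (a * \<theta> N)) / of_real ((\<theta> N)\<^sup>2)) +
              \<i> * of_real ((a * t N - \<nu> N) / sqrt (m N)) * of_real u)) \<longlonglongrightarrow>
          exp (\<i> * of_real y * of_real u - of_real k * (of_real u)\<^sup>2)"
        by (rule tendsto_exp)
      moreover have "eventually (\<lambda>N. \<bar>\<theta> N\<bar> < pi) sequentially"
        using \<theta>0 by (intro order_tendstoD(2)[OF tendsto_rabs_zero]) auto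
      with m_pos \<theta>_nz have "eventually (\<lambda>N. exp (of_real (t N / m N) * of_real (u\<^sup>2) *
              ((g (\<theta> N) - \<i> * of_real (a * \<theta> N)) / of_real ((\<theta> N)\<^sup>2)) +
              \<i> * of_real ((a * t N - \<nu> N) / sqrt (m N)) * of_real u) = s N u) sequentially"
      proof eventually_elim
        case (elim N)
        have "complex_of_real (t N / m N) * of_real (u\<^sup>2) = of_real (t N * (\<theta> N)\<^sup>2)"
          using elim by (simp add: \<theta>_def power_divide)
        moreover have "complex_of_real ((a * t N - \<nu> N) / sqrt (m N)) * of_real u =
            of_real ((a * t N - \<nu> N) * \<theta> N)"
          by (simp add: \<theta>_def)
        ultimately have "of_real (t N / m N) * of_real (u\<^sup>2) *
              ((g (\<theta> N) - \<i> * of_real (a * \<theta> N)) / of_real ((\<theta> N)\<^sup>2)) +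
              \<i> * of_real ((a * t N - \<nu> N) / sqrt (m N)) * of_real u =
            of_real (t N * (\<theta> N)\<^sup>2) * ((g (\<theta> N) - \<i> * of_real (a * \<theta> N)) / of_real ((\<theta> N)\<^sup>2)) +
            \<i> * of_real ((a * t N - \<nu> N) * \<theta> N)"
          by (simp only: mult.assoc)
        also have "\<dots> = of_real (t N) * g (\<theta> N) - \<i> * of_real (\<nu> N * \<theta> N)"
          using elim by (simp add: field_simps)
        finally have "exp (of_real (t N / m N) * of_real (u\<^sup>2) *
              ((g (\<theta> N) - \<i> * of_real (a * \<theta> N)) / of_real ((\<theta> N)\<^sup>2)) +
              \<i> * of_real ((a * t N - \<nu> N) / sqrt (m N)) * of_real u) = F N (\<theta> N)"
          by (simp only: F_def)
        moreover have "s N u = indicator {-pi..pi} (\<theta> N) *\<^sub>R F N (\<theta> N)"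
          by (simp only: s_def \<theta>_def)
        moreover have "\<theta> N \<in> {-pi..pi}"
          using elim by (auto simp: abs_less_iff)
        ultimately show ?case
          by simp
      qed
      ultimately show ?thesis
        by (rule Lim_transform_eventually)
    qed
    \<comment> \<open>The majorant holds only from \<open>N0\<close> on, so the sequence is shifted
      before dominated convergence is applied.\<close>
    show ?thesis
    proof (rule LIMSEQ_offset[where k = N0], rule integral_dominated_convergence)
      show "integrable lborel w"
        unfolding w_def using gaussian_integral[of "\<tau> / 2 * c"] pos
        by (auto simp: has_bochner_integral_iff)
      have "AE u in lborel. u \<noteq> (0 :: real)"
        by (rule AE_lborel_singleton)
      then show "AE u in lborel. (\<lambda>N. s (N + N0) u) \<longlonglongrightarrow>
          exp (\<i> * of_real y * of_real u - of_real k * (of_real u)\<^sup>2)"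
        by eventually_elim (intro LIMSEQ_ignore_initial_segment lim)
      show "AE u in lborel. norm (s (N + N0) u) \<le> w u" for N
        using N0[of "N + N0"] by simp
    qed (use meas in auto)
  qed
  also have "(LINT u|lborel. exp (\<i> * of_real y * of_real u - of_real k * (of_real u)\<^sup>2)) =
      complex_of_real (sqrt (2 * pi / (\<tau> * b)) * exp (- y\<^sup>2 / (2 * \<tau> * b)))"
    using gaussian_fourier[OF k, of y] by (simp add: k_def field_simps)
  finally show ?thesis
    using scale unfolding F_def by (subst tendsto_cong) simp_all
qed

section \<open>Local densities\<close>

lemma has_integral_periodic_shift:
  fixes f :: "real \<Rightarrow> complex"
  assumes "(f has_integral I) {0..2 * pi}" "\<And>x. f (x + 2 * pi) = f x"
  shows "(f has_integral I) {-pi..pi}"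
proof -
  have int: "f integrable_on {0..2 * pi}"
    using assms(1) by blast
  have 1: "(f has_integral integral {0..pi} f) {0..pi}"
    by (rule integrable_integral, rule integrable_on_subinterval[OF int]) auto
  have 2: "(f has_integral integral {pi..2 * pi} f) {pi..2 * pi}"
    by (rule integrable_integral, rule integrable_on_subinterval[OF int]) auto
  have "(f has_integral (integral {0..pi} f + integral {pi..2 * pi} f)) {0..2 * pi}"
    by (rule has_integral_combine[OF _ _ 1 2]) auto
  then have I: "I = integral {0..pi} f + integral {pi..2 * pi} f"
    using assms(1) has_integral_unique by blast
  have "((f \<circ> (+) (2 * pi)) has_integral integral {pi..2 * pi} f) {-pi..0}"
    using 2 by (subst has_integral_shift_Icc_real) simp
  moreover have "f \<circ> (+) (2 * pi) = f"
    using assms(2) by (auto simp: add.commute)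
  ultimately have "(f has_integral integral {pi..2 * pi} f) {-pi..0}"
    by simp
  from has_integral_combine[OF _ _ this 1] show ?thesis
    by (simp add: I add.commute)
qed

text \<open>Cauchy's formula for the \<open>n\<close>-th derivative at 0, written in the angle. The
  symmetric interval puts the saddle at angle 0 into its interior.\<close>

lemma fps_nth_circle_integral:
  fixes f :: "complex \<Rightarrow> complex"
  assumes "f holomorphic_on UNIV" "f has_fps_expansion F" "r > 0"
  shows "(LINT \<theta>:{-pi..pi}|lborel. f (of_real r * cis \<theta>) * exp (- (\<i> * of_real (real n * \<theta>)))) =
    2 * of_real pi * of_real r ^ n * fps_nth F n"
proof -
  let ?h = "\<lambda>\<theta>. f (of_real r * cis \<theta>) * exp (- (\<i> * of_real (real n * \<theta>)))"
  have cont: "continuous_on UNIV f"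
    using assms(1) holomorphic_on_imp_continuous_on by blast
  have "((\<lambda>u. f u / (u - 0) ^ Suc n) has_contour_integral
          (2 * pi * \<i>) / fact n * (deriv ^^ n) f 0) (circlepath 0 r)"
    using assms by (intro Cauchy_has_contour_integral_higher_derivative_circlepath)
      (auto intro: continuous_on_subset[OF cont] holomorphic_on_subset)
  then have "((\<lambda>t. f (of_real r * cis t) / (of_real r * cis t) ^ Suc n * r * \<i> * cis t)
      has_integral (2 * pi * \<i>) / fact n * (deriv ^^ n) f 0) {0..2 * pi}"
    unfolding circlepath_def by (subst (asm) has_contour_integral_part_circlepath_iff) auto
  then have "((\<lambda>t. of_real r ^ n / \<i> * (f (of_real r * cis t) / (of_real r * cis t) ^ Suc n * r * \<i> * cis t))
      has_integral of_real r ^ n / \<i> * ((2 * pi * \<i>) / fact n * (deriv ^^ n) f 0)) {0..2 * pi}"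
    by (rule has_integral_mult_right)
  also have "(\<lambda>t. of_real r ^ n / \<i> * (f (of_real r * cis t) / (of_real r * cis t) ^ Suc n * r * \<i> * cis t)) = ?h"
  proof
    fix t
    have "exp (- (\<i> * of_real (real n * t))) = inverse (cis t ^ n)"
      by (simp add: cis_conv_exp exp_minus mult_ac flip: exp_of_nat_mult)
    then show "of_real r ^ n / \<i> * (f (of_real r * cis t) / (of_real r * cis t) ^ Suc n * r * \<i> * cis t) = ?h t"
      using assms(3) by (simp add: field_simps power_mult_distrib)
  qed
  finally have "(?h has_integral (2 * of_real pi * of_real r ^ n * fps_nth F n)) {0..2 * pi}"
    by (simp add: fps_nth_fps_expansion[OF assms(2)] mult_ac)
  then have "(?h has_integral (2 * of_real pi * of_real r ^ n * fps_nth F n)) {-pi..pi}"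
  proof (rule has_integral_periodic_shift)
    fix x
    have "exp (- (\<i> * of_real (real n * (x + 2 * pi)))) = exp (- (\<i> * of_real (real n * x)))"
      unfolding exp_eq by (rule exI[of _ "- int n"]) (simp add: algebra_simps)
    moreover have "cis (x + 2 * pi) = cis x"
      by (simp add: cis_conv_exp algebra_simps exp_add)
    ultimately show "?h (x + 2 * pi) = ?h x"
      by simp
  qed
  moreover have "set_integrable lborel {-pi..pi} ?h"
    by (intro borel_integrable_atLeastAtMost' continuous_intros continuous_on_compose2[OF cont]) auto
  ultimately show ?thesis
    using set_borel_integral_eq_integral(2) integral_unique by metis
qed

text \<open>
  \<open>local_density L n t\<close> is the mass at \<open>n\<close> of a signed compound Poisson law with time parameter \<open>t\<close>,
  and \<open>t * log_cf L \<theta>\<close> is the logarithm of its characteristic function.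
\<close>

definition log_cf :: "real \<Rightarrow> real \<Rightarrow> complex" where
  "log_cf r \<theta> = of_real (exp (- r)) - exp (- (of_real r * cis \<theta>))"

definition local_density :: "real \<Rightarrow> nat \<Rightarrow> real \<Rightarrow> complex" where
  "local_density L n t =
     poly (signed_touchard n) (of_real t) / fact n * of_real (L ^ n * exp (- (t * (1 - exp (- L)))))"

lemma continuous_on_log_cf [continuous_intros]: "continuous_on A (log_cf r)"
  unfolding log_cf_def by (intro continuous_intros)

lemma signed_touchard_circle_integral:
  assumes "r > 0"
  shows "2 * of_real pi * of_real r ^ n * (poly (signed_touchard n) (of_real t) / fact n) =
    (LINT \<theta>:{-pi..pi}|lborel. exp (of_real t * (1 - exp (- (of_real r * cis \<theta>)))) *
       exp (- (\<i> * of_real (real n * \<theta>))))"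
proof -
  let ?f = "(\<lambda>z. exp (complex_of_real t * z)) \<circ> (\<lambda>z. 1 - exp (- z))"
  have "(\<lambda>z. 1 - exp (- z)) has_fps_expansion fps_one_minus_exp_neg"
    unfolding fps_one_minus_exp_neg_def by (intro fps_expansion_intros)
  then have "?f has_fps_expansion (fps_exp (of_real t) oo fps_one_minus_exp_neg)"
    by (intro has_fps_expansion_compose fps_expansion_intros) (simp_all add: fps_one_minus_exp_neg_nth)
  moreover have "?f holomorphic_on UNIV"
    unfolding o_def by (intro holomorphic_intros)
  moreover have "fps_nth (fps_exp (of_real t) oo fps_one_minus_exp_neg) n = poly (signed_touchard n) (of_real t) / fact n"
    by (simp add: fps_compose_nth poly_signed_touchard atLeast0AtMost)
  ultimately show ?thesis
    using fps_nth_circle_integral[of ?f "fps_exp (of_real t) oo fps_one_minus_exp_neg" r n] assms by simp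
qed

text \<open>The normalisation stays at \<open>L\<close> while the radius \<open>r\<close> of
  integration is free. The price of moving it is the explicit prefactor, which reduces to
  \<open>1 / (2 * pi)\<close> at \<open>r = L\<close>.\<close>

lemma local_density_circle:
  assumes "r > 0"
  shows "local_density L n t = of_real ((L / r) ^ n * exp (t * (exp (- L) - exp (- r))) / (2 * pi)) *
    (LINT \<theta>:{-pi..pi}|lborel. exp (of_real t * log_cf r \<theta> - \<i> * of_real (real n * \<theta>)))"
proof -
  let ?I = "LINT \<theta>:{-pi..pi}|lborel. exp (of_real t * log_cf r \<theta> - \<i> * of_real (real n * \<theta>))"
  have "(\<lambda>\<theta>. exp (of_real t * (1 - exp (- (of_real r * cis \<theta>)))) * exp (- (\<i> * of_real (real n * \<theta>)))) =
      (\<lambda>\<theta>. of_real (exp (t * (1 - exp (- r)))) *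
        exp (of_real t * log_cf r \<theta> - \<i> * of_real (real n * \<theta>)))"
    by (simp add: fun_eq_iff log_cf_def algebra_simps flip: exp_of_real exp_add exp_diff)
  then have "2 * of_real pi * of_real r ^ n * (poly (signed_touchard n) (of_real t) / fact n) =
      of_real (exp (t * (1 - exp (- r)))) * ?I"
    using signed_touchard_circle_integral[OF assms, of n t] by simp
  then have signed_touchard: "poly (signed_touchard n) (of_real t) / fact n =
      of_real (exp (t * (1 - exp (- r))) / (2 * pi * r ^ n)) * ?I"
    using assms by (simp add: field_simps)
  have const: "exp (t * (1 - exp (- r))) / (2 * pi * r ^ n) * (L ^ n * exp (- (t * (1 - exp (- L))))) =
      (L / r) ^ n * exp (t * (exp (- L) - exp (- r))) / (2 * pi)"
  proof -
    have "exp (t * (1 - exp (- r))) * exp (- (t * (1 - exp (- L)))) = exp (t * (exp (- L) - exp (- r)))"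
      by (simp add: algebra_simps flip: exp_add)
    then show ?thesis
      by (simp add: power_divide field_simps)
  qed
  show ?thesis
    unfolding local_density_def signed_touchard const[symmetric] of_real_mult[of "exp (t * (1 - exp (- r))) / (2 * pi * r ^ n)"]
    by (rule mult.commute[THEN trans]) (simp only: mult.assoc mult.commute mult.left_commute)
qed

lemma Re_log_cf_le:
  assumes "0 < r" "r < 1" "\<bar>\<theta>\<bar> \<le> pi"
  shows "Re (log_cf r \<theta>) \<le> - (r * exp (- r) * (1 - r) / 16) * \<theta>\<^sup>2"
  using Re_exp_neg_cis_ge[OF assms] by (simp add: log_cf_def Re_exp)

text \<open>The integrand is bounded by 1 and by a Gaussian of width of order
  \<open>1 / sqrt t\<close>. The first bound survives \<open>t \<rightarrow> 0\<close>; the second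
  has the order of a local limit.\<close>

lemma circle_integral_log_cf_bounds:
  fixes r t \<nu> :: real
  assumes "0 < r" "r < 1" "t \<ge> 0"
  defines "I \<equiv> LINT \<theta>:{-pi..pi}|lborel. exp (of_real t * log_cf r \<theta> - \<i> * of_real (\<nu> * \<theta>))"
  shows "norm I \<le> 2 * pi"
    and "t > 0 \<Longrightarrow> norm I \<le> sqrt (pi / (t * (r * exp (- r) * (1 - r) / 16)))"
proof -
  define c where "c = r * exp (- r) * (1 - r) / 16"
  have c: "c > 0"
    using assms by (simp add: c_def)
  let ?h = "\<lambda>\<theta>. exp (of_real t * log_cf r \<theta> - \<i> * of_real (\<nu> * \<theta>))"
  have int: "set_integrable lborel {-pi..pi} ?h"
    by (intro borel_integrable_atLeastAtMost' continuous_intros)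
  have norm_h: "norm (?h \<theta>) \<le> exp (- (t * c) * \<theta>\<^sup>2)" if "\<theta> \<in> {-pi..pi}" for \<theta>
  proof -
    have "t * Re (log_cf r \<theta>) \<le> t * (- c * \<theta>\<^sup>2)"
      using Re_log_cf_le[of r \<theta>] assms that by (intro mult_left_mono) (auto simp: c_def)
    then show ?thesis
      by (simp add: mult.assoc)
  qed
  have "norm I \<le> (LINT \<theta>:{-pi..pi}|lborel. norm (?h \<theta>))"
    unfolding I_def by (rule set_integral_norm_bound[OF int])
  moreover have "\<dots> \<le> (LINT \<theta>:{-pi..pi}|lborel. 1)"
  proof (rule set_integral_mono)
    show "set_integrable lborel {-pi..pi} (\<lambda>\<theta>. norm (?h \<theta>))"
      using int by (rule set_integrable_norm)
    show "norm (?h \<theta>) \<le> 1" if "\<theta> \<in> {-pi..pi}" for \<theta>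
      using norm_h[OF that] by (rule order_trans) (use c assms in simp)
  qed (simp add: set_integrable_def)
  ultimately show "norm I \<le> 2 * pi"
    by (simp add: set_lebesgue_integral_def)
  assume "t > 0"
  then have tc: "t * c > 0"
    using c by simp
  have "(LINT \<theta>:{-pi..pi}|lborel. norm (?h \<theta>)) \<le> (LINT \<theta>|lborel. exp (- (t * c) * \<theta>\<^sup>2))"
    unfolding set_lebesgue_integral_def
  proof (rule integral_mono)
    show "integrable lborel (\<lambda>\<theta>. indicator {-pi..pi} \<theta> *\<^sub>R norm (?h \<theta>))"
      using set_integrable_norm[OF int] by (simp add: set_integrable_def)
    show "integrable lborel (\<lambda>\<theta>. exp (- (t * c) * \<theta>\<^sup>2))"
      using gaussian_integral[OF tc] by (simp add: has_bochner_integral_iff)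
    show "indicator {-pi..pi} \<theta> *\<^sub>R norm (?h \<theta>) \<le> exp (- (t * c) * \<theta>\<^sup>2)" for \<theta>
      using norm_h[of \<theta>] by (auto simp: indicator_def)
  qed
  also have "\<dots> = sqrt (pi / (t * c))"
    using gaussian_integral[OF tc] by (simp add: has_bochner_integral_iff)
  finally show "norm I \<le> sqrt (pi / (t * (r * exp (- r) * (1 - r) / 16)))"
    using \<open>norm I \<le> (LINT \<theta>:{-pi..pi}|lborel. norm (?h \<theta>))\<close> by (simp add: c_def)
qed

lemma norm_local_density_le:
  assumes "0 < L" "0 < r" "r < 1" "t \<ge> 0"
  shows "norm (local_density L n t) \<le> (L / r) ^ n * exp (t * (exp (- L) - exp (- r)))"
    and "t > 0 \<Longrightarrow> norm (local_density L n t) \<le> (L / r) ^ n * exp (t * (exp (- L) - exp (- r))) *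
           (sqrt (pi / (t * (r * exp (- r) * (1 - r) / 16))) / (2 * pi))"
proof -
  define A where "A = (L / r) ^ n * exp (t * (exp (- L) - exp (- r)))"
  define I where "I = (LINT \<theta>:{-pi..pi}|lborel. exp (of_real t * log_cf r \<theta> - \<i> * of_real (real n * \<theta>)))"
  have A: "A \<ge> 0"
    using assms by (simp add: A_def)
  have "norm (local_density L n t) = norm (of_real (A / (2 * pi)) * I)"
    unfolding A_def I_def by (subst local_density_circle[OF assms(2)]) (rule refl)
  then have eq: "norm (local_density L n t) = A * (norm I / (2 * pi))"
    using A by (simp add: norm_mult norm_divide)
  have "norm I / (2 * pi) \<le> 1"
    using circle_integral_log_cf_bounds(1)[OF assms(2-4), of "real n"] by (simp add: I_def)
  then show "norm (local_density L n t) \<le> (L / r) ^ n * exp (t * (exp (- L) - exp (- r)))"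
    using mult_left_mono[OF _ A, of "norm I / (2 * pi)" 1] by (simp add: eq A_def)
  assume "t > 0"
  then have "norm I / (2 * pi) \<le> sqrt (pi / (t * (r * exp (- r) * (1 - r) / 16))) / (2 * pi)"
    using circle_integral_log_cf_bounds(2)[OF assms(2-4), of "real n"]
    by (intro divide_right_mono) (auto simp: I_def)
  then show "norm (local_density L n t) \<le> (L / r) ^ n * exp (t * (exp (- L) - exp (- r))) *
           (sqrt (pi / (t * (r * exp (- r) * (1 - r) / 16))) / (2 * pi))"
    unfolding eq A_def[symmetric] by (rule mult_left_mono) (rule A)
qed

section \<open>Exponential tails\<close>

lemma ln_one_plus_ge:
  fixes x :: real
  assumes "\<bar>x\<bar> \<le> 1 / 2"
  shows "x - 2 * x\<^sup>2 \<le> ln (1 + x)"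
proof (cases "x \<ge> 0")
  case True
  then have "x - x\<^sup>2 \<le> ln (1 + x)"
    using assms by (intro ln_one_plus_pos_lower_bound) auto
  then show ?thesis
    using zero_le_power2[of x] by linarith
next
  case False
  then show ?thesis
    using assms ln_one_minus_pos_lower_bound[of "- x"] by auto
qed

text \<open>To first order in \<delta>, moving the radius changes the exponent by \<delta> times the
  distance from \<open>n\<close> to the mean \<open>t * L * exp (- L)\<close>. The convexity bound
  \<open>1 - exp (- x) \<le> x\<close> costs nothing further, and the logarithm costs at most
  \<open>2 * n * \<delta>\<^sup>2\<close>.\<close>

lemma radius_shift_le:
  fixes L \<delta> t :: real
  assumes "0 < L" "\<bar>\<delta>\<bar> \<le> 1 / 2" "t \<ge> 0"
  shows "(L / (L * (1 + \<delta>))) ^ n * exp (t * (exp (- L) - exp (- (L * (1 + \<delta>)))))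
    \<le> exp (\<delta> * (t * L * exp (- L) - n) + 2 * real n * \<delta>\<^sup>2)"
proof -
  have \<delta>: "1 + \<delta> > 0"
    using assms by (auto simp: abs_le_iff)
  then have "L / (L * (1 + \<delta>)) = inverse (1 + \<delta>)"
    using assms by (simp add: inverse_eq_divide)
  then have "(L / (L * (1 + \<delta>))) ^ n = exp (- (n * ln (1 + \<delta>)))"
    using \<delta> by (simp add: exp_minus exp_of_nat_mult power_inverse)
  moreover have "exp (- L) - exp (- (L * (1 + \<delta>))) = exp (- L) * (1 - exp (- (L * \<delta>)))"
    by (simp add: algebra_simps flip: exp_add)
  ultimately have "(L / (L * (1 + \<delta>))) ^ n * exp (t * (exp (- L) - exp (- (L * (1 + \<delta>))))) =
      exp (t * exp (- L) * (1 - exp (- (L * \<delta>))) - n * ln (1 + \<delta>))"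
    by (simp only: exp_add[symmetric]) (simp add: mult.assoc)
  also have "\<dots> \<le> exp (t * exp (- L) * (L * \<delta>) - n * (\<delta> - 2 * \<delta>\<^sup>2))"
  proof -
    have "1 - exp (- (L * \<delta>)) \<le> L * \<delta>"
      using exp_ge_add_one_self[of "- (L * \<delta>)"] by linarith
    then have "t * exp (- L) * (1 - exp (- (L * \<delta>))) \<le> t * exp (- L) * (L * \<delta>)"
      using assms by (intro mult_left_mono) auto
    moreover have "n * (\<delta> - 2 * \<delta>\<^sup>2) \<le> n * ln (1 + \<delta>)"
      using ln_one_plus_ge[OF assms(2)] by (intro mult_left_mono) auto
    ultimately show ?thesis
      by simp
  qed
  finally show ?thesis
    by (simp add: algebra_simps)
qed

text \<open>The radius is moved by the relative amount \<open>1 / sqrt n\<close>, against the sign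
  of mean minus \<open>n\<close>. The linear term then gives the decay, and the quadratic error is
  exactly the 2 in the exponent. Both bounds are kept because the one with \<open>1 / sqrt t\<close>
  is useless near \<open>t = 0\<close>.\<close>

lemma local_density_tail:
  fixes L :: real
  assumes "0 < L" "L < 1"
  shows "\<exists>C>0. \<forall>\<^sub>F n in sequentially. \<forall>t>0.
    norm (local_density L n t) \<le> exp (2 - \<bar>t * L * exp (- L) - n\<bar> / sqrt n) \<and>
    norm (local_density L n t) \<le> exp (2 - \<bar>t * L * exp (- L) - n\<bar> / sqrt n) * (C / sqrt t)"
proof -
  \<comment> \<open>A lower bound for the decay constant, uniform over the radii with
    \<open>L / 2 \<le> r \<le> (1 + L) / 2\<close>.\<close>
  define c0 where "c0 = L / 2 * exp (- 1) * ((1 - L) / 2) / 16"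
  define C where "C = sqrt (pi / c0) / (2 * pi)"
  have c0: "c0 > 0"
    using assms by (simp add: c0_def)
  then have C: "C > 0"
    by (simp add: C_def)
  \<comment> \<open>Relative shifts below \<epsilon> keep the radius within this range.\<close>
  define \<epsilon> where "\<epsilon> = min (1 / 2) ((1 - L) / (2 * L))"
  have \<epsilon>: "\<epsilon> > 0" "\<epsilon> \<le> 1 / 2" "L * \<epsilon> \<le> (1 - L) / 2"
    using assms by (auto simp: \<epsilon>_def min_def field_simps)
  have "(\<lambda>n. 1 / sqrt (real n)) \<longlonglongrightarrow> 0"
    by (intro tendsto_divide_0[OF tendsto_const] filterlim_at_top_imp_at_infinity
        filterlim_compose[OF sqrt_at_top filterlim_real_sequentially])
  then have "\<forall>\<^sub>F n in sequentially. 1 / sqrt (real n) < \<epsilon>"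
    using \<epsilon> by (intro order_tendstoD) auto
  then have "\<forall>\<^sub>F n in sequentially. \<forall>t>0.
    norm (local_density L n t) \<le> exp (2 - \<bar>t * L * exp (- L) - n\<bar> / sqrt n) \<and>
    norm (local_density L n t) \<le> exp (2 - \<bar>t * L * exp (- L) - n\<bar> / sqrt n) * (C / sqrt t)"
    using eventually_gt_at_top[of 0]
  proof eventually_elim
    case (elim n)
    show ?case
    proof (intro allI impI)
      fix t :: real assume t: "t > 0"
      define s where "s = t * L * exp (- L)"
      define \<delta> where "\<delta> = (if s \<ge> n then - 1 else 1) / sqrt n"
      define r where "r = L * (1 + \<delta>)"
      have \<delta>: "\<bar>\<delta>\<bar> < \<epsilon>" "\<delta>\<^sup>2 = 1 / n" "\<delta> * (s - n) = - \<bar>s - n\<bar> / sqrt n"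
        using elim by (auto simp: \<delta>_def power_divide diff_divide_distrib)
      have "\<bar>L * \<delta>\<bar> = L * \<bar>\<delta>\<bar>"
        using assms by (simp add: abs_mult)
      also have "\<dots> \<le> L * \<epsilon>"
        using \<delta> assms by (intro mult_left_mono) auto
      finally have abs: "\<bar>L * \<delta>\<bar> \<le> L * \<epsilon>" .
      have "L * \<epsilon> \<le> L * (1 / 2)"
        using \<epsilon> assms by (intro mult_left_mono) auto
      then have "L * (1 / 2) \<le> L + L * \<delta>" "L + L * \<delta> \<le> L + (1 - L) / 2"
        using abs \<epsilon>(3) unfolding abs_le_iff by linarith+
      then have r: "L / 2 \<le> r" "r \<le> (1 + L) / 2"
        unfolding r_def by (simp_all add: field_simps)
      then have r01: "0 < r" "r < 1"
        using assms by (simp_all add: field_simps)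
      have "(L / r) ^ n * exp (t * (exp (- L) - exp (- r))) \<le> exp (\<delta> * (s - n) + 2 * real n * \<delta>\<^sup>2)"
        unfolding r_def s_def using \<delta> \<epsilon> assms t by (intro radius_shift_le) auto
      also have "\<delta> * (s - n) + 2 * real n * \<delta>\<^sup>2 = 2 - \<bar>s - n\<bar> / sqrt n"
        using elim by (simp add: \<delta>)
      finally have main: "(L / r) ^ n * exp (t * (exp (- L) - exp (- r))) \<le> exp (2 - \<bar>s - n\<bar> / sqrt n)" .
      have "c0 \<le> r * exp (- r) * (1 - r) / 16"
        unfolding c0_def using r r01 assms
        by (intro divide_right_mono mult_mono) (auto simp: field_simps)
      then have "pi / (t * (r * exp (- r) * (1 - r) / 16)) \<le> pi / (t * c0)"
        using c0 t by (intro divide_left_mono mult_left_mono mult_pos_pos) auto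
      then have "sqrt (pi / (t * (r * exp (- r) * (1 - r) / 16))) / (2 * pi) \<le> sqrt (pi / (t * c0)) / (2 * pi)"
        by (intro divide_right_mono real_sqrt_le_mono) auto
      also have "\<dots> = C / sqrt t"
        by (simp add: C_def real_sqrt_divide real_sqrt_mult)
      finally have gauss: "sqrt (pi / (t * (r * exp (- r) * (1 - r) / 16))) / (2 * pi) \<le> C / sqrt t" .
      have "norm (local_density L n t) \<le> (L / r) ^ n * exp (t * (exp (- L) - exp (- r))) *
          (sqrt (pi / (t * (r * exp (- r) * (1 - r) / 16))) / (2 * pi))"
        using norm_local_density_le(2)[OF assms(1) r01, of t n] t by simp
      also have "\<dots> \<le> exp (2 - \<bar>s - n\<bar> / sqrt n) * (C / sqrt t)"
        using main gauss r01 t by (intro mult_mono) auto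
      finally have "norm (local_density L n t) \<le> exp (2 - \<bar>s - n\<bar> / sqrt n) * (C / sqrt t)" .
      moreover have "norm (local_density L n t) \<le> exp (2 - \<bar>s - n\<bar> / sqrt n)"
        using norm_local_density_le(1)[OF assms(1) r01, of t n] t main by simp
      ultimately show "norm (local_density L n t) \<le> exp (2 - \<bar>t * L * exp (- L) - n\<bar> / sqrt n) \<and>
        norm (local_density L n t) \<le> exp (2 - \<bar>t * L * exp (- L) - n\<bar> / sqrt n) * (C / sqrt t)"
        by (simp add: s_def)
    qed
  qed
  with C show ?thesis
    by blast
qed

text \<open>The tail bounds must absorb the factor \<open>sqrt (m N)\<close>. If \<open>t\<close>
  has the order of \<open>m N\<close> or more, the factor \<open>1 / sqrt t\<close> does this.
  Otherwise \<open>y\<close> is at least of order \<open>sqrt (m N)\<close> in absolute value, and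
  half of the exponential decay pays for it.\<close>

lemma local_density_rescaled_le:
  fixes L :: real and m :: "nat \<Rightarrow> real" and n :: "nat \<Rightarrow> nat"
  assumes L: "0 < L" "L < 1" and m: "filterlim m at_top sequentially"
    and close: "\<And>N. \<bar>n N - m N\<bar> \<le> 1"
  shows "\<exists>K>0. \<forall>\<^sub>F N in sequentially. \<forall>y. m N + sqrt (m N) * y > 0 \<longrightarrow>
    sqrt (m N) * norm (local_density L (n N) ((m N + sqrt (m N) * y) / (L * exp (- L)))) \<le> K * exp (- \<bar>y\<bar> / 4)"
proof -
  obtain C where C: "C > 0" and tail: "\<forall>\<^sub>F n in sequentially. \<forall>t>0.
    norm (local_density L n t) \<le> exp (2 - \<bar>t * L * exp (- L) - n\<bar> / sqrt n) \<and>
    norm (local_density L n t) \<le> exp (2 - \<bar>t * L * exp (- L) - n\<bar> / sqrt n) * (C / sqrt t)"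
    using local_density_tail[OF L] by blast
  have "filterlim (\<lambda>N. real (n N)) at_top sequentially"
  proof (rule filterlim_at_top_mono)
    show "filterlim (\<lambda>N. m N - 1) at_top sequentially"
      using m by (simp add: filterlim_tendsto_add_at_top[OF tendsto_const[of "- 1"], simplified])
    show "\<forall>\<^sub>F N in sequentially. m N - 1 \<le> real (n N)"
      using close by (intro always_eventually) (auto simp: abs_le_iff algebra_simps)
  qed
  then have "filterlim n sequentially sequentially"
    by (simp add: filterlim_sequentially_iff_filterlim_real)
  then have "\<forall>\<^sub>F N in sequentially. \<forall>t>0.
    norm (local_density L (n N) t) \<le> exp (2 - \<bar>t * L * exp (- L) - n N\<bar> / sqrt (n N)) \<and>
    norm (local_density L (n N) t) \<le> exp (2 - \<bar>t * L * exp (- L) - n N\<bar> / sqrt (n N)) * (C / sqrt t)"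
    using tail by (rule filterlim_iff[THEN iffD1, rule_format])
  moreover have "\<forall>\<^sub>F N in sequentially. m N \<ge> 2"
    using m by (simp add: filterlim_at_top)
  ultimately have "\<forall>\<^sub>F N in sequentially. \<forall>y. m N + sqrt (m N) * y > 0 \<longrightarrow>
    sqrt (m N) * norm (local_density L (n N) ((m N + sqrt (m N) * y) / (L * exp (- L))))
      \<le> exp 3 * (2 * C + 8) * exp (- \<bar>y\<bar> / 4)"
  proof eventually_elim
    case (elim N)
    show ?case
    proof (intro allI impI)
      fix y assume pos: "m N + sqrt (m N) * y > 0"
      define s where "s = m N + sqrt (m N) * y"
      define t where "t = s / (L * exp (- L))"
      define D where "D = norm (local_density L (n N) t)"
      have m2: "m N \<ge> 2" and sqrt_m: "sqrt (m N) \<ge> 1"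
        using elim by auto
      have t: "t > 0" "t * L * exp (- L) = s"
        using pos L by (auto simp: t_def s_def)
      have D: "D \<le> exp (2 - \<bar>s - n N\<bar> / sqrt (n N))"
          "D \<le> exp (2 - \<bar>s - n N\<bar> / sqrt (n N)) * (C / sqrt t)"
        using elim(1) t unfolding D_def by auto
      have n: "n N > 0" "n N \<le> 4 * m N"
        using close[of N] m2 by (auto simp: abs_le_iff intro!: gr0I)
      \<comment> \<open>Replacing \<open>n N\<close> by \<open>m N\<close> in the numerator raises
        the constant from 2 to 3; \<open>n N \<le> 4 * m N\<close> in the denominator halves the
        rate.\<close>
      have exponent: "2 - \<bar>s - n N\<bar> / sqrt (n N) \<le> 3 - \<bar>y\<bar> / 2"
      proof -
        have "sqrt (n N) \<le> sqrt (4 * m N)"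
          using n by (intro real_sqrt_le_mono)
        then have "sqrt (n N) \<le> 2 * sqrt (m N)"
          by (simp add: real_sqrt_mult)
        then have "\<bar>y\<bar> * sqrt (n N) \<le> \<bar>y\<bar> * (2 * sqrt (m N))"
          by (intro mult_left_mono) auto
        moreover have "\<bar>s - m N\<bar> = sqrt (m N) * \<bar>y\<bar>"
          using m2 by (simp add: s_def abs_mult)
        moreover have "\<bar>s - m N\<bar> \<le> \<bar>s - n N\<bar> + 1"
          using close[of N] by linarith
        moreover have "\<bar>y\<bar> * (2 * sqrt (m N)) = 2 * (sqrt (m N) * \<bar>y\<bar>)"
          by simp
        ultimately have "\<bar>y\<bar> * sqrt (n N) \<le> 2 * \<bar>s - n N\<bar> + 2"
          by linarith
        moreover have "sqrt (n N) \<ge> 1"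
          using n by simp
        ultimately have "\<bar>y\<bar> * sqrt (n N) \<le> 2 * \<bar>s - n N\<bar> + 2 * sqrt (n N)"
          by linarith
        then show ?thesis
          using n by (simp add: field_simps)
      qed
      have exp_split: "exp (3 - \<bar>y\<bar> / 2) = exp 3 * exp (- \<bar>y\<bar> / 4) * exp (- \<bar>y\<bar> / 4)"
        by (simp flip: exp_add)
      have "sqrt (m N) * D \<le> exp 3 * (2 * C + 8) * exp (- \<bar>y\<bar> / 4)"
      proof (cases "s \<ge> m N / 2")
        case True
        have "L * exp (- L) \<le> 1 * 1"
          using L by (intro mult_mono) auto
        then have "m N * (L * exp (- L)) \<le> m N"
          using m2 by (simp add: mult_left_le)
        also have "\<dots> \<le> 4 * s"
          using True m2 by linarith
        finally have "m N \<le> 4 * t"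
          using L by (simp add: t_def field_simps)
        then have "sqrt (m N) \<le> sqrt (4 * t)"
          by (rule real_sqrt_le_mono)
        then have m_t: "sqrt (m N) \<le> 2 * sqrt t"
          by (simp add: real_sqrt_mult)
        have "exp (2 - \<bar>s - n N\<bar> / sqrt (n N)) * (C / sqrt t) \<le> exp (3 - \<bar>y\<bar> / 2) * (C / sqrt t)"
          using exponent C t(1) by (intro mult_right_mono) auto
        with D(2) have "D \<le> exp (3 - \<bar>y\<bar> / 2) * (C / sqrt t)"
          by (rule order_trans)
        then have "sqrt (m N) * D \<le> 2 * sqrt t * (exp (3 - \<bar>y\<bar> / 2) * (C / sqrt t))"
          using m_t t by (intro mult_mono) (auto simp: D_def)
        also have "\<dots> = exp 3 * (2 * C) * exp (- \<bar>y\<bar> / 4) * exp (- \<bar>y\<bar> / 4)"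
          using t by (simp add: exp_split)
        also have "\<dots> \<le> exp 3 * (2 * C + 8) * exp (- \<bar>y\<bar> / 4) * 1"
          using C by (intro mult_mono) auto
        finally show ?thesis
          by simp
      next
        case False
        \<comment> \<open>Here \<open>s < m N / 2\<close> makes \<open>- y\<close> at least
          \<open>sqrt (m N) / 2\<close>; the constant 8 is twice the 4 in the target exponent
          \<open>- \<bar>y\<bar> / 4\<close>.\<close>
        then have "sqrt (m N) * (sqrt (m N) / 2) \<le> sqrt (m N) * (- y)"
          using m2 by (simp add: s_def)
        then have "sqrt (m N) / 2 \<le> - y"
          using m2 by (subst (asm) mult_le_cancel_left_pos) auto
        then have "sqrt (m N) \<le> 8 * (\<bar>y\<bar> / 4)"
          by linarith
        also have "\<dots> \<le> 8 * exp (\<bar>y\<bar> / 4)"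
          using exp_ge_add_one_self[of "\<bar>y\<bar> / 4"] by linarith
        finally have "sqrt (m N) \<le> 8 * exp (\<bar>y\<bar> / 4)" .
        moreover have "D \<le> exp (3 - \<bar>y\<bar> / 2)"
          using D(1) exponent by (elim order_trans) simp
        ultimately have "sqrt (m N) * D \<le> 8 * exp (\<bar>y\<bar> / 4) * exp (3 - \<bar>y\<bar> / 2)"
          by (intro mult_mono) (auto simp: D_def)
        also have "\<dots> = exp 3 * 8 * exp (- \<bar>y\<bar> / 4)"
          unfolding exp_split by (simp add: exp_minus field_simps)
        also have "\<dots> \<le> exp 3 * (2 * C + 8) * exp (- \<bar>y\<bar> / 4)"
          using C by (intro mult_right_mono mult_left_mono) auto
        finally show ?thesis .
      qed
      then show "sqrt (m N) * norm (local_density L (n N) ((m N + sqrt (m N) * y) / (L * exp (- L))))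
          \<le> exp 3 * (2 * C + 8) * exp (- \<bar>y\<bar> / 4)"
        by (simp add: D_def t_def s_def)
    qed
  qed
  moreover have "exp 3 * (2 * C + 8) > 0"
    using C by simp
  ultimately show ?thesis
    by blast
qed

section \<open>Quadratic expansions and local limits\<close>

text \<open>Supplies the expansion hypothesis of the saddle point lemma. After the linear term is
  removed, division by \<open>z ^ 2\<close> is a shift of the power series, and its sum is
  continuous at 0.\<close>

lemma fps_quadratic_limit:
  fixes f :: "complex \<Rightarrow> complex"
  assumes "f has_fps_expansion F" "fps_nth F 0 = 0"
  shows "((\<lambda>\<theta>. (f (of_real \<theta>) - fps_nth F 1 * of_real \<theta>) / of_real (\<theta>\<^sup>2)) \<longlongrightarrow> fps_nth F 2) (at 0)"
proof -
  define G where "G = F - fps_const (fps_nth F 1) * fps_X"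
  have G: "(\<lambda>z. f z - fps_nth F 1 * z) has_fps_expansion G"
    unfolding G_def by (intro fps_expansion_intros assms)
  have "fps_nth G k = 0" if "k < 2" for k
    using that assms(2) by (auto simp: G_def less_2_cases_iff)
  then have sub: "G = 0 \<or> 2 \<le> subdegree G"
    by (metis subdegree_geI)
  have "((\<lambda>z. (f z - fps_nth F 1 * z) / z ^ 2) \<longlongrightarrow> fps_nth F 2) (at 0)"
  \<comment> \<open>The zero series has subdegree 0 by convention, so the shift by 2 is justified
    only for \<open>G \<noteq> 0\<close>.\<close>
  proof (cases "G = 0")
    case True
    then have "eventually (\<lambda>z. f z - fps_nth F 1 * z = 0) (nhds 0)"
      using G by (simp add: has_fps_expansion_0_iff)
    then have "eventually (\<lambda>z. 0 = (f z - fps_nth F 1 * z) / z ^ 2) (at 0)"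
      unfolding eventually_at_filter by eventually_elim simp
    moreover have "fps_nth F 2 = 0"
      using arg_cong[OF True, of "\<lambda>G. fps_nth G 2"] by (simp add: G_def)
    ultimately show ?thesis
      using Lim_transform_eventually[OF tendsto_const] by metis
  next
    case False
    let ?h = "\<lambda>z. if z = 0 then fps_nth G 2 else (f z - fps_nth F 1 * z) / z ^ 2"
    have "?h has_fps_expansion fps_shift 2 G"
      using has_fps_expansion_shift[OF G, of 2 "fps_nth G 2"] sub False by simp
    then have "isCont ?h 0"
      by (rule has_fps_expansion_imp_continuous)
    then have "(?h \<longlongrightarrow> fps_nth G 2) (at 0)"
      by (simp add: isCont_def)
    moreover have "eventually (\<lambda>z. ?h z = (f z - fps_nth F 1 * z) / z ^ 2) (at 0)"
      by (simp add: eventually_at_filter)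
    ultimately have "((\<lambda>z. (f z - fps_nth F 1 * z) / z ^ 2) \<longlongrightarrow> fps_nth G 2) (at 0)"
      by (rule Lim_transform_eventually)
    then show ?thesis
      by (simp add: G_def)
  qed
  moreover have "filterlim complex_of_real (at 0) (at 0)"
    by (auto simp: filterlim_at eventually_at_filter intro!: tendsto_eq_intros)
  ultimately show ?thesis
    by (auto dest: filterlim_compose)
qed

text \<open>Factoring out \<open>exp (- L)\<close> leaves a composition with
  \<open>exp (\<i> * \<theta>) - 1\<close>, whose series has no constant term and can be composed
  formally. The quadratic coefficient combines \<open>- L / 2\<close> from the inner series with
  \<open>L\<^sup>2 / 2\<close> from its square; this is the origin of \<open>1 - L\<close>.\<close>

lemma log_cf_expand:
  "((\<lambda>\<theta>. (log_cf L \<theta> - \<i> * of_real (L * exp (- L) * \<theta>)) / of_real (\<theta>\<^sup>2))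
     \<longlongrightarrow> - of_real (L * exp (- L) * (1 - L)) / 2) (at 0)"
proof -
  define W where "W = fps_exp \<i> - 1"
  define F where "F = fps_const (of_real (exp (- L))) * (1 - (fps_exp (- of_real L) oo W))"
  let ?f = "\<lambda>z. of_real (exp (- L)) * (1 - ((\<lambda>z. exp (- of_real L * z)) \<circ> (\<lambda>z. exp (\<i> * z) - 1)) z)"
  have "(\<lambda>z. exp (\<i> * z) - 1) has_fps_expansion W"
    unfolding W_def by (intro fps_expansion_intros)
  then have f: "?f has_fps_expansion F"
    unfolding F_def by (intro fps_expansion_intros) (simp_all add: W_def)
  have "?f (of_real \<theta>) = log_cf L \<theta>" for \<theta>
    by (simp add: log_cf_def cis_conv_exp algebra_simps flip: exp_of_real exp_add)
  moreover have W: "fps_nth W 0 = 0" "fps_nth W 1 = \<i>" "fps_nth W 2 = - 1 / 2" "fps_nth (W ^ 2) 1 = 0" "fps_nth (W ^ 2) 2 = - 1"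
    by (simp_all add: W_def power2_eq_square fps_mult_nth numeral_2_eq_2)
  have F0: "fps_nth F 0 = 0"
    by (simp add: F_def)
  moreover have F1: "fps_nth F 1 = \<i> * of_real (L * exp (- L))"
    using W by (simp add: F_def fps_compose_nth)
  moreover have F2: "fps_nth F 2 = - of_real (L * exp (- L) * (1 - L)) / 2"
    using W by (simp add: F_def fps_compose_nth numeral_2_eq_2 field_simps)
  ultimately show ?thesis
    using fps_quadratic_limit[OF f] by (simp only: mult.assoc of_real_mult)
qed

text \<open>The Poisson case. The factors 1 are kept visible to match the saddle point lemma with
  \<open>a = b = 1\<close>.\<close>

lemma cis_expand:
  "((\<lambda>\<theta>. (cis \<theta> - 1 - \<i> * of_real (1 * \<theta>)) / of_real (\<theta>\<^sup>2)) \<longlongrightarrow> - of_real 1 / 2) (at 0)"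
proof -
  have "(\<lambda>z. exp (\<i> * z) - 1) has_fps_expansion (fps_exp \<i> - 1)"
    by (intro fps_expansion_intros)
  from fps_quadratic_limit[OF this] show ?thesis
    by (simp add: cis_conv_exp numeral_2_eq_2)
qed

lemma close_div_sqrt_tendsto_0:
  fixes m x :: "nat \<Rightarrow> real"
  assumes m: "filterlim m at_top sequentially" and close: "\<And>N. \<bar>x N\<bar> \<le> 1"
  shows "(\<lambda>N. x N / sqrt (m N)) \<longlonglongrightarrow> 0"
proof (rule tendsto_0_le[where K = 1])
  show "(\<lambda>N. 1 / sqrt (m N)) \<longlonglongrightarrow> 0"
    by (intro tendsto_divide_0[OF tendsto_const] filterlim_at_top_imp_at_infinity
        filterlim_compose[OF sqrt_at_top m])
  show "\<forall>\<^sub>F N in sequentially. norm (x N / sqrt (m N)) \<le> norm (1 / sqrt (m N)) * 1"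
    using close by (intro always_eventually) (auto intro!: divide_right_mono)
qed

text \<open>Cauchy's formula for \<open>exp\<close> on the circle of radius \<open>m N\<close>, with
  \<open>cis \<theta> - 1\<close> as exponent. It takes the place of Stirling's formula and
  tolerates a distance of up to 1 between \<open>n N\<close> and the mean.\<close>

lemma poisson_local_limit:
  fixes m :: "nat \<Rightarrow> real" and n :: "nat \<Rightarrow> nat"
  assumes m: "filterlim m at_top sequentially" and close: "\<And>N. \<bar>n N - m N\<bar> \<le> 1"
  shows "(\<lambda>N. sqrt (m N) * exp (- m N) * m N ^ n N / fact (n N)) \<longlonglongrightarrow> 1 / sqrt (2 * pi)"
proof -
  let ?I = "\<lambda>N. LINT \<theta>:{-pi..pi}|lborel. exp (of_real (m N) * (cis \<theta> - 1) - \<i> * of_real (n N * \<theta>))"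
  have m_pos: "\<forall>\<^sub>F N in sequentially. m N > 0"
    using m by (simp add: filterlim_at_top_dense)
  have "(\<lambda>N. of_real (sqrt (m N)) * ?I N) \<longlonglongrightarrow>
      of_real (sqrt (2 * pi / (1 * 1)) * exp (- 0\<^sup>2 / (2 * 1 * 1)))"
  proof (rule saddle_point[OF _ cis_expand])
    show "continuous_on UNIV (\<lambda>\<theta>. cis \<theta> - 1)"
      by (intro continuous_intros)
    show "Re (cis \<theta> - 1) \<le> - (1 / 8) * \<theta>\<^sup>2" if "\<bar>\<theta>\<bar> \<le> pi" for \<theta>
      using one_minus_cos_ge[OF that] by simp
    show "(\<lambda>N. m N / m N) \<longlonglongrightarrow> 1"
      by (rule Lim_transform_eventually[OF tendsto_const]) (use m_pos in eventually_elim, simp)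
    show "(\<lambda>N. (1 * m N - n N) / sqrt (m N)) \<longlonglongrightarrow> 0"
      using close by (intro close_div_sqrt_tendsto_0 m) (auto simp: abs_minus_commute)
  qed (use m in auto)
  moreover have "\<forall>\<^sub>F N in sequentially. of_real (sqrt (m N)) * ?I N =
      complex_of_real (2 * pi * (sqrt (m N) * exp (- m N) * m N ^ n N / fact (n N)))"
    using m_pos
  proof eventually_elim
    case (elim N)
    have "?I N = of_real (exp (- m N)) * (LINT \<theta>:{-pi..pi}|lborel. exp (of_real (m N) * cis \<theta>) * exp (- (\<i> * of_real (n N * \<theta>))))"
      by (subst set_integral_mult_right[symmetric], rule set_lebesgue_integral_cong)
        (auto simp: algebra_simps simp flip: exp_of_real exp_add exp_diff)
    also have "\<dots> = of_real (exp (- m N)) * (2 * of_real pi * of_real (m N) ^ n N * fps_nth (fps_exp 1) (n N))"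
      by (subst fps_nth_circle_integral[OF _ has_fps_expansion_exp1 elim]) (auto intro!: holomorphic_intros)
    finally show ?case
      by simp
  qed
  ultimately have "(\<lambda>N. complex_of_real (2 * pi * (sqrt (m N) * exp (- m N) * m N ^ n N / fact (n N))))
      \<longlonglongrightarrow> of_real (sqrt (2 * pi / (1 * 1)) * exp (- 0\<^sup>2 / (2 * 1 * 1)))"
    by (rule Lim_transform_eventually)
  then have "(\<lambda>N. 2 * pi * (sqrt (m N) * exp (- m N) * m N ^ n N / fact (n N))) \<longlonglongrightarrow> sqrt (2 * pi)"
    unfolding tendsto_of_real_iff by simp
  then have "(\<lambda>N. 1 / (2 * pi) * (2 * pi * (sqrt (m N) * exp (- m N) * m N ^ n N / fact (n N))))
      \<longlonglongrightarrow> 1 / (2 * pi) * sqrt (2 * pi)"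
    by (rule tendsto_mult_left)
  moreover have "1 / (2 * pi) * sqrt (2 * pi) = 1 / sqrt (2 * pi)"
    using real_div_sqrt[of "2 * pi"] by (simp add: field_simps)
  ultimately show ?thesis
    by simp
qed

lemma local_density_limit:
  fixes L y :: real and m :: "nat \<Rightarrow> real" and n :: "nat \<Rightarrow> nat"
  assumes L: "0 < L" "L < 1" and m: "filterlim m at_top sequentially"
    and close: "\<And>N. \<bar>n N - m N\<bar> \<le> 1"
  shows "(\<lambda>N. of_real (sqrt (m N)) * local_density L (n N) ((m N + sqrt (m N) * y) / (L * exp (- L))))
    \<longlonglongrightarrow> complex_of_real (1 / sqrt (2 * pi * (1 - L)) * exp (- y\<^sup>2 / (2 * (1 - L))))"
proof -
  define a where "a = L * exp (- L)"
  define t where "t = (\<lambda>N. (m N + sqrt (m N) * y) / a)"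
  have a: "a > 0"
    using L by (simp add: a_def)
  have m_pos: "\<forall>\<^sub>F N in sequentially. m N > 0"
    using m by (simp add: filterlim_at_top_dense)
  let ?I = "\<lambda>N. LINT \<theta>:{-pi..pi}|lborel. exp (of_real (t N) * log_cf L \<theta> - \<i> * of_real (n N * \<theta>))"
  \<comment> \<open>With \<open>\<tau> = 1 / a\<close> and \<open>b = a * (1 - L)\<close> the
    limiting variance \<open>\<tau> * b\<close> is \<open>1 - L\<close>.\<close>
  have "(\<lambda>N. of_real (sqrt (m N)) * ?I N) \<longlonglongrightarrow>
      complex_of_real (sqrt (2 * pi / (1 / a * (a * (1 - L)))) * exp (- y\<^sup>2 / (2 * (1 / a) * (a * (1 - L)))))"
  proof (rule saddle_point)
    show "continuous_on UNIV (log_cf L)"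
      by (rule continuous_on_log_cf)
    show "((\<lambda>\<theta>. (log_cf L \<theta> - \<i> * of_real (a * \<theta>)) / of_real (\<theta>\<^sup>2))
        \<longlongrightarrow> - of_real (a * (1 - L)) / 2) (at 0)"
      unfolding a_def by (rule log_cf_expand)
    show "Re (log_cf L \<theta>) \<le> - (L * exp (- L) * (1 - L) / 16) * \<theta>\<^sup>2" if "\<bar>\<theta>\<bar> \<le> pi" for \<theta>
      using that by (rule Re_log_cf_le[OF L])
    have "(\<lambda>N. 1 / a + y / a * (1 / sqrt (m N))) \<longlonglongrightarrow> 1 / a + y / a * 0"
      by (intro tendsto_intros close_div_sqrt_tendsto_0 m) simp
    moreover have "\<forall>\<^sub>F N in sequentially. 1 / a + y / a * (1 / sqrt (m N)) = t N / m N"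
      using m_pos by eventually_elim (use a in \<open>simp add: t_def field_simps\<close>)
    ultimately show "(\<lambda>N. t N / m N) \<longlonglongrightarrow> 1 / a"
      by (simp add: Lim_transform_eventually)
    have "(\<lambda>N. y + (m N - n N) / sqrt (m N)) \<longlonglongrightarrow> y + 0"
      using close by (intro tendsto_intros close_div_sqrt_tendsto_0 m) (auto simp: abs_minus_commute)
    moreover have "\<forall>\<^sub>F N in sequentially. y + (m N - n N) / sqrt (m N) = (a * t N - n N) / sqrt (m N)"
      using m_pos by eventually_elim (use a in \<open>simp add: t_def field_simps\<close>)
    ultimately show "(\<lambda>N. (a * t N - n N) / sqrt (m N)) \<longlonglongrightarrow> y"
      by (simp add: Lim_transform_eventually)
  qed (use a L m in auto)
  then have "(\<lambda>N. of_real (1 / (2 * pi)) * (of_real (sqrt (m N)) * ?I N)) \<longlonglongrightarrow> of_real (1 / (2 * pi)) *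
      complex_of_real (sqrt (2 * pi / (1 / a * (a * (1 - L)))) * exp (- y\<^sup>2 / (2 * (1 / a) * (a * (1 - L)))))"
    by (rule tendsto_mult_left)
  moreover have "of_real (1 / (2 * pi)) * (of_real (sqrt (m N)) * ?I N) =
      of_real (sqrt (m N)) * local_density L (n N) (t N)" for N
    using L by (simp add: local_density_circle[OF L(1)])
  moreover have "1 / (2 * pi) * (sqrt (2 * pi / (1 / a * (a * (1 - L)))) * exp (- y\<^sup>2 / (2 * (1 / a) * (a * (1 - L)))))
      = 1 / sqrt (2 * pi * (1 - L)) * exp (- y\<^sup>2 / (2 * (1 - L)))"
  proof -
    have "1 / k * sqrt (k / v) = 1 / sqrt (k * v)" if "k > 0" "v > 0" for k v :: real
    proof -
      have "1 / k * sqrt (k / v) = (sqrt k / k) / sqrt v"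
        by (simp add: real_sqrt_divide)
      also have "sqrt k / k = 1 / sqrt k"
        using that real_div_sqrt[of k] by (simp add: field_simps)
      finally show ?thesis
        by (simp add: real_sqrt_mult)
    qed
    from this[of "2 * pi" "1 - L"] have sqrt: "1 / (2 * pi) * sqrt (2 * pi / (1 - L)) = 1 / sqrt (2 * pi * (1 - L))"
      using L by simp
    have "1 / a * (a * (1 - L)) = 1 - L" "2 * (1 / a) * (a * (1 - L)) = 2 * (1 - L)"
      using a by simp_all
    then show ?thesis
      using sqrt by (metis mult.assoc)
  qed
  ultimately show ?thesis
    unfolding t_def a_def by (simp only: of_real_mult[symmetric])
qed

lemma integrable_exp_neg_abs:
  fixes a :: real
  assumes "a > 0"
  shows "integrable lborel (\<lambda>y. exp (- (a * \<bar>y\<bar>)))"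
proof -
  define f where "f = (\<lambda>t :: real. indicator {0..} t * exp (- t))"
  have "(\<lambda>t. norm (indicator {0..} t *\<^sub>R (exp (- complex_of_real t) * poly 1 (of_real t)))) = f"
    by (auto simp: f_def fun_eq_iff indicator_def)
  then have f: "integrable lborel f"
    using integrable_norm[OF has_bochner_integral_laplace[of 1, THEN integrable.intros]] by simp
  have "integrable lborel (\<lambda>y. f (0 + a * y) + f (0 + (- a) * y))"
    using assms by (intro Bochner_Integration.integrable_add lborel_integrable_real_affine f) auto
  then show ?thesis
  proof (rule Bochner_Integration.integrable_bound)
    show "AE y in lborel. norm (exp (- (a * \<bar>y\<bar>))) \<le> norm (f (0 + a * y) + f (0 + (- a) * y))"
      using assms by (intro AE_I2)
        (auto simp: f_def indicator_def abs_if zero_le_mult_iff mult_le_0_iff split: if_splits)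
  qed simp
qed

lemma gaussian_power_integral:
  assumes "p \<ge> 1" "v > 0"
  shows "(LINT y|lborel. (\<Prod>i<p. complex_of_real (1 / sqrt (2 * pi * v) * exp (- y\<^sup>2 / (2 * v))))) =
    complex_of_real ((1 / sqrt (2 * pi * v)) ^ p * sqrt (2 * pi * v / p))"
proof -
  have "(\<Prod>i<p. complex_of_real (1 / sqrt (2 * pi * v) * exp (- y\<^sup>2 / (2 * v)))) =
      of_real ((1 / sqrt (2 * pi * v)) ^ p * exp (- (p / (2 * v)) * y\<^sup>2))" for y
  proof -
    have "exp (- y\<^sup>2 / (2 * v)) ^ p = exp (- (p / (2 * v)) * y\<^sup>2)"
      by (simp flip: exp_of_nat_mult)
    then show ?thesis
      by (simp only: prod_constant card_lessThan of_real_power[symmetric] power_mult_distrib)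
  qed
  then show ?thesis
    using gaussian_integral[of "p / (2 * v)"] assms
    by (simp add: has_bochner_integral_iff field_simps)
qed

text \<open>Under \<open>t = (m N + sqrt (m N) * y) / a\<close> each of the \<open>p\<close> factors
  needs one \<open>sqrt (m N)\<close>, and the Jacobian supplies one of them together with
  \<open>1 / a\<close>; hence the normalisation \<open>sqrt (m N) ^ p / sqrt (m N)\<close>. The
  limit of the integrand is a product of \<open>p\<close> equal Gaussians.\<close>

lemma integral_prod_local_density_limit:
  fixes L :: real and m :: "nat \<Rightarrow> real" and n :: "nat \<Rightarrow> nat \<Rightarrow> nat"
  assumes L: "0 < L" "L < 1" and p: "p \<ge> 1" and m: "filterlim m at_top sequentially"
    and close: "\<And>N i. i < p \<Longrightarrow> \<bar>n N i - m N\<bar> \<le> 1"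
  shows "(\<lambda>N. of_real (sqrt (m N) ^ p / sqrt (m N)) *
            (LINT t:{0..}|lborel. \<Prod>i<p. local_density L (n N i) t))
    \<longlonglongrightarrow> complex_of_real (1 / (L * exp (- L)) *
          ((1 / sqrt (2 * pi * (1 - L))) ^ p * sqrt (2 * pi * (1 - L) / p)))"
proof -
  define a where "a = L * exp (- L)"
  define t where "t = (\<lambda>N y. (m N + sqrt (m N) * y) / a)"
  define P where "P = (\<lambda>N t. \<Prod>i<p. local_density L (n N i) t)"
  \<comment> \<open>The open half-line matches the majorants, which hold for positive
    \<open>t\<close>; the endpoint is a null set.\<close>
  define s where "s = (\<lambda>N y. indicator {0<..} (t N y) *\<^sub>R (\<Prod>i<p. of_real (sqrt (m N)) * local_density L (n N i) (t N y)))"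
  have a: "a > 0"
    using L by (simp add: a_def)
  have m_pos: "\<forall>\<^sub>F N in sequentially. m N > 0"
    using m by (simp add: filterlim_at_top_dense)
  have cont: "continuous_on UNIV (local_density L k)" for k
    unfolding local_density_def by (intro continuous_intros) auto
  have [measurable]: "local_density L k \<in> borel_measurable borel" for k
    by (rule borel_measurable_continuous_onI[OF cont])
  have [measurable]: "P N \<in> borel_measurable borel" "s N \<in> borel_measurable borel" for N
    unfolding P_def s_def t_def by measurable
  have scale: "\<forall>\<^sub>F N in sequentially. of_real (1 / a) * (LINT y|lborel. s N y) =
      of_real (sqrt (m N) ^ p / sqrt (m N)) * (LINT t:{0..}|lborel. P N t)"
    using m_pos
  proof eventually_elim
    case (elim N)
    have "AE t in lborel. t \<noteq> (0 :: real)"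
      by (rule AE_lborel_singleton)
    then have "(LINT t:{0..}|lborel. P N t) = (LINT t|lborel. indicator {0<..} t *\<^sub>R P N t)"
      unfolding set_lebesgue_integral_def
      by (intro integral_cong_AE) (auto simp: indicator_def elim!: eventually_mono)
    also have "\<dots> = (sqrt (m N) / a) *\<^sub>R (LINT y|lborel. indicator {0<..} (t N y) *\<^sub>R P N (t N y))"
      using elim a by (subst lborel_integral_real_affine[where c = "sqrt (m N) / a" and t = "m N / a"])
        (auto simp: t_def add_divide_distrib)
    finally have "of_real (sqrt (m N) ^ p / sqrt (m N)) * (LINT t:{0..}|lborel. P N t) =
      of_real (1 / a) * (of_real (sqrt (m N) ^ p) * (LINT y|lborel. indicator {0<..} (t N y) *\<^sub>R P N (t N y)))"
      using elim by (simp add: scaleR_conv_of_real)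
    also have "of_real (sqrt (m N) ^ p) * (LINT y|lborel. indicator {0<..} (t N y) *\<^sub>R P N (t N y)) = (LINT y|lborel. s N y)"
      by (subst integral_mult_right_zero[symmetric])
        (simp add: s_def P_def prod.distrib scaleR_conv_of_real mult_ac)
    finally show ?case ..
  qed
  have "\<exists>K. \<forall>i<p. K i > 0 \<and> (\<forall>\<^sub>F N in sequentially. \<forall>y. m N + sqrt (m N) * y > 0 \<longrightarrow>
      sqrt (m N) * norm (local_density L (n N i) (t N y)) \<le> K i * exp (- \<bar>y\<bar> / 4))"
    using local_density_rescaled_le[OF L m, of "\<lambda>N. n N i" for i] close unfolding t_def a_def
    by (intro choice) blast
  then obtain K where K: "\<And>i. i < p \<Longrightarrow> K i > 0"
    and K_bound: "\<And>i. i < p \<Longrightarrow> \<forall>\<^sub>F N in sequentially. \<forall>y. m N + sqrt (m N) * y > 0 \<longrightarrow>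
      sqrt (m N) * norm (local_density L (n N i) (t N y)) \<le> K i * exp (- \<bar>y\<bar> / 4)"
    by blast
  have "\<forall>\<^sub>F N in sequentially. \<forall>i\<in>{..<p}. \<forall>y. m N + sqrt (m N) * y > 0 \<longrightarrow>
      sqrt (m N) * norm (local_density L (n N i) (t N y)) \<le> K i * exp (- \<bar>y\<bar> / 4)"
    using K_bound by (intro eventually_ball_finite) auto
  then have "\<forall>\<^sub>F N in sequentially. \<forall>y. norm (s N y) \<le> (\<Prod>i<p. K i) * exp (- (p / 4 * \<bar>y\<bar>))"
    using m_pos
  proof eventually_elim
    case (elim N)
    show ?case
    proof
      fix y
      have K0: "(\<Prod>i<p. K i) \<ge> 0"
        using K by (intro prod_nonneg) (auto simp: less_imp_le)
      show "norm (s N y) \<le> (\<Prod>i<p. K i) * exp (- (p / 4 * \<bar>y\<bar>))"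
      proof (cases "t N y > 0")
        case True
        then have "m N + sqrt (m N) * y > 0"
          using a by (simp add: t_def zero_less_divide_iff)
        then have "norm (s N y) \<le> (\<Prod>i<p. K i * exp (- \<bar>y\<bar> / 4))"
          using elim True by (auto simp: s_def norm_mult simp flip: prod_norm intro!: prod_mono)
        also have "\<dots> = (\<Prod>i<p. K i) * exp (- (p / 4 * \<bar>y\<bar>))"
          by (simp add: prod.distrib flip: exp_of_nat_mult)
        finally show ?thesis .
      qed (use K0 in \<open>simp add: s_def\<close>)
    qed
  qed
  then obtain N0 where N0: "norm (s N y) \<le> (\<Prod>i<p. K i) * exp (- (p / 4 * \<bar>y\<bar>))" if "N \<ge> N0" for N y
    unfolding eventually_sequentially by blast
  have lim: "(\<lambda>N. s N y) \<longlonglongrightarrow>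
      (\<Prod>i<p. complex_of_real (1 / sqrt (2 * pi * (1 - L)) * exp (- y\<^sup>2 / (2 * (1 - L)))))" for y
  proof -
    have "(\<lambda>N. \<Prod>i<p. of_real (sqrt (m N)) * local_density L (n N i) (t N y)) \<longlonglongrightarrow>
        (\<Prod>i<p. complex_of_real (1 / sqrt (2 * pi * (1 - L)) * exp (- y\<^sup>2 / (2 * (1 - L)))))"
      unfolding t_def a_def using close
      by (intro tendsto_prod local_density_limit[OF L m]) auto
    moreover have "\<forall>\<^sub>F N in sequentially. sqrt (m N) > - y"
      using filterlim_compose[OF sqrt_at_top m] by (simp add: filterlim_at_top_dense)
    with m_pos have "\<forall>\<^sub>F N in sequentially.
        (\<Prod>i<p. of_real (sqrt (m N)) * local_density L (n N i) (t N y)) = s N y"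
    proof eventually_elim
      case (elim N)
      have "sqrt (m N) * (sqrt (m N) + y) > 0"
        using elim by (intro mult_pos_pos) auto
      then have "t N y > 0"
        using elim a by (simp add: t_def algebra_simps)
      then show ?case
        by (simp add: s_def)
    qed
    ultimately show ?thesis
      by (rule Lim_transform_eventually)
  qed
  have "(\<lambda>N. LINT y|lborel. s N y) \<longlonglongrightarrow>
      (LINT y|lborel. (\<Prod>i<p. complex_of_real (1 / sqrt (2 * pi * (1 - L)) * exp (- y\<^sup>2 / (2 * (1 - L))))))"
  proof (rule LIMSEQ_offset[where k = N0], rule integral_dominated_convergence)
    show "integrable lborel (\<lambda>y. (\<Prod>i<p. K i) * exp (- (p / 4 * \<bar>y\<bar>)))"
      using p by (intro integrable_mult_right integrable_exp_neg_abs) auto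
    show "AE y in lborel. (\<lambda>N. s (N + N0) y) \<longlonglongrightarrow>
        (\<Prod>i<p. complex_of_real (1 / sqrt (2 * pi * (1 - L)) * exp (- y\<^sup>2 / (2 * (1 - L)))))"
      by (intro AE_I2 LIMSEQ_ignore_initial_segment lim)
    show "AE y in lborel. norm (s (N + N0) y) \<le> (\<Prod>i<p. K i) * exp (- (p / 4 * \<bar>y\<bar>))" for N
      using N0[of "N + N0"] by simp
  qed simp_all
  then have "(\<lambda>N. of_real (1 / a) * (LINT y|lborel. s N y)) \<longlonglongrightarrow>
      of_real (1 / a) * of_real ((1 / sqrt (2 * pi * (1 - L))) ^ p * sqrt (2 * pi * (1 - L) / p))"
    using gaussian_power_integral[OF p, of "1 - L"] L by (intro tendsto_mult_left) simp
  then have "(\<lambda>N. of_real (sqrt (m N) ^ p / sqrt (m N)) * (LINT t:{0..}|lborel. P N t)) \<longlonglongrightarrow>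
      of_real (1 / a) * of_real ((1 / sqrt (2 * pi * (1 - L))) ^ p * sqrt (2 * pi * (1 - L) / p))"
    using scale by (rule Lim_transform_eventually)
  then show ?thesis
    by (simp only: P_def a_def of_real_mult)
qed

section \<open>Asymptotics for Turan graphs\<close>

lemma acyclic_orientations_integral:
  fixes L :: real
  assumes "finite V" "\<And>v. v \<in> V \<Longrightarrow> c v < p" "p \<ge> 1" "of_nat p * (1 - exp (- L)) = (1 :: real)"
  defines "n \<equiv> \<lambda>i. card {v \<in> V. c v = i}"
  shows "(LINT t:{0..}|lborel. \<Prod>i<p. local_density L (n i) t) =
    of_real (card (acyclic_orientations c V) * L ^ (\<Sum>i<p. n i) / (\<Prod>i<p. fact (n i)))"
proof -
  let ?A = "(\<Prod>i<p. signed_touchard (n i))"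
  define k where "k = complex_of_real (L ^ (\<Sum>i<p. n i) / (\<Prod>i<p. fact (n i)))"
  have "(\<Prod>i<p. local_density L (n i) t) = k * (exp (- complex_of_real t) * poly ?A (of_real t))" for t
  proof -
    have "(\<Prod>i<p. exp (- (t * (1 - exp (- L))))) = exp (- (t * (of_nat p * (1 - exp (- L)))))"
      by (simp add: mult_ac flip: exp_of_nat_mult)
    also have "\<dots> = exp (- t)"
      by (simp only: assms(4) mult_1_right)
    finally have "(\<Prod>i<p. exp (- (t * (1 - exp (- L))))) = exp (- t)" .
    then have "(\<Prod>i<p. complex_of_real (exp (- (t * (1 - exp (- L)))))) = exp (- complex_of_real t)"
      by (simp only: exp_of_real flip: of_real_prod of_real_minus)
    then show ?thesis
      by (simp add: local_density_def k_def poly_prod prod.distrib prod_dividef power_sum)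
  qed
  then have "(LINT t:{0..}|lborel. \<Prod>i<p. local_density L (n i) t) =
      k * (LINT t:{0..}|lborel. exp (- complex_of_real t) * poly ?A (of_real t))"
    by simp
  also have "(LINT t:{0..}|lborel. exp (- complex_of_real t) * poly ?A (of_real t)) = laplace ?A"
    unfolding set_lebesgue_integral_def
    by (rule has_bochner_integral_integral_eq[OF has_bochner_integral_laplace])
  also have "\<dots> = of_nat (card (acyclic_orientations c V))"
    unfolding n_def by (rule card_acyclic_orientations[OF assms(1,2), symmetric])
  finally show ?thesis
    by (simp add: k_def)
qed

lemma AO_complete_multipartite:
  assumes "parcs G = multipartite_arcs c (pverts G)"
  shows "AO G = card (acyclic_orientations c (pverts G))"
  unfolding AO_def acyclic_orientations_def is_orientation_def assms by (simp add: conj_assoc)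

lemma balanced_parts_close:
  fixes x :: "nat \<Rightarrow> nat"
  assumes "\<And>i j. i < p \<Longrightarrow> j < p \<Longrightarrow> x i \<le> x j + 1" "i < p"
  shows "\<bar>x i - (\<Sum>j<p. x j) / p\<bar> \<le> (1 :: real)"
proof -
  have le: "real (x j) \<le> real (x k) + 1" if "j < p" "k < p" for j k
    using assms(1)[OF that] by linarith
  have "real p * x i = (\<Sum>j<p. real (x i))"
    by simp
  also have "\<dots> \<le> (\<Sum>j<p. real (x j) + 1)"
    using assms(2) by (intro sum_mono le) auto
  finally have "real p * x i \<le> (\<Sum>j<p. real (x j)) + p"
    by (simp add: sum.distrib)
  moreover have "(\<Sum>j<p. real (x j)) \<le> (\<Sum>j<p. real (x i) + 1)"
    using assms(2) by (intro sum_mono le) auto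
  then have "(\<Sum>j<p. real (x j)) \<le> real p * x i + p"
    by (simp add: algebra_simps)
  ultimately show ?thesis
    using assms(2) by (simp add: abs_le_iff field_simps)
qed

lemma sum_card_color_classes:
  fixes c :: "'a \<Rightarrow> nat"
  assumes "finite V" "\<And>v. v \<in> V \<Longrightarrow> c v < p"
  shows "(\<Sum>i<p. card {v \<in> V. c v = i}) = card V"
proof -
  have "(\<Sum>i<p. \<Sum>v | v \<in> V \<and> c v = i. 1) = (\<Sum>v\<in>V. 1 :: nat)"
    using assms by (intro sum.group) auto
  then show ?thesis
    by simp
qed

theorem theorem3:
  fixes p :: nat and T :: "nat \<Rightarrow> 'a pair_pre_digraph" and L :: real
  assumes "p \<ge> 2"
    and "\<And>N. is_turan_graph N p (T N)"
    and "L = ln (real p / (real p - 1))"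
  shows "(\<lambda>N. real (AO (T N))) \<sim>[at_top]
         (\<lambda>N. fact N /
            ((real p - 1) * (1 - L) powr ((real p - 1) / 2) * real p ^ N * L ^ (N + 1)))"
proof -
  have p: "real p \<ge> 2"
    using assms(1) by simp
  have exp_L: "exp (- L) = (real p - 1) / real p"
    using p by (simp add: assms(3) exp_minus)
  have L0: "0 < L"
    using p by (simp add: assms(3))
  \<comment> \<open>This is where \<open>p \<ge> 2\<close> is decisive: the worst case is
    \<open>L = ln 2\<close>.\<close>
  have L1: "L < 1"
  proof -
    have "real p / (real p - 1) \<le> 2"
      using p by (simp add: field_simps)
    then have "L \<le> ln 2"
      using p by (simp add: assms(3))
    then show ?thesis
      using ln2_le_25_over_36 by simp
  qed
  have pL: "real p * (1 - exp (- L)) = 1"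
    using p by (simp add: exp_L field_simps)
  have "\<forall>N. \<exists>c :: 'a \<Rightarrow> nat. (\<forall>v \<in> pverts (T N). c v < p) \<and>
      parcs (T N) = multipartite_arcs c (pverts (T N)) \<and>
      (\<forall>i < p. \<forall>j < p. card {v \<in> pverts (T N). c v = i} \<le> card {v \<in> pverts (T N). c v = j} + 1)"
    using assms(2) unfolding is_turan_graph_def multipartite_arcs_def by blast
  from choice[OF this] obtain c :: "nat \<Rightarrow> 'a \<Rightarrow> nat" where
    c: "\<forall>N. (\<forall>v \<in> pverts (T N). c N v < p) \<and>
      parcs (T N) = multipartite_arcs (c N) (pverts (T N)) \<and>
      (\<forall>i < p. \<forall>j < p. card {v \<in> pverts (T N). c N v = i} \<le> card {v \<in> pverts (T N). c N v = j} + 1)"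
    by (rule exE)
  have c_less: "\<And>N v. v \<in> pverts (T N) \<Longrightarrow> c N v < p"
    and arcs: "\<And>N. parcs (T N) = multipartite_arcs (c N) (pverts (T N))"
    and balanced: "\<And>N i j. i < p \<Longrightarrow> j < p \<Longrightarrow>
      card {v \<in> pverts (T N). c N v = i} \<le> card {v \<in> pverts (T N). c N v = j} + 1"
    using c by blast+
  have fin: "finite (pverts (T N))" for N
  proof -
    interpret pair_graph "T N"
      using assms(2)[of N] by (simp add: is_turan_graph_def)
    show ?thesis
      by (rule pair_finite_verts)
  qed
  have card: "card (pverts (T N)) = N" for N
    using assms(2)[of N] by (simp add: is_turan_graph_def)
  define n where "n = (\<lambda>N i. card {v \<in> pverts (T N). c N v = i})"
  define m where "m = (\<lambda>N. real N / real p)"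
  have sum_n: "(\<Sum>i<p. n N i) = N" for N
    unfolding n_def using sum_card_color_classes[OF fin c_less] card by simp
  have "filterlim (\<lambda>N. 1 / real p * real N) at_top sequentially"
    using p by (intro filterlim_tendsto_pos_mult_at_top[OF tendsto_const] filterlim_real_sequentially) auto
  then have m: "filterlim m at_top sequentially"
    by (simp add: m_def)
  have close: "\<bar>n N i - m N\<bar> \<le> 1" if "i < p" for N i
  proof -
    have "(\<Sum>j<p. real (n N j)) = real N"
      by (simp only: sum_n flip: of_nat_sum)
    moreover have "n N i \<le> n N j + 1" if "i < p" "j < p" for i j
      unfolding n_def using balanced that .
    ultimately show ?thesis
      using balanced_parts_close[of p "n N" i] that by (simp add: m_def)
  qed
  \<comment> \<open>\<open>I\<close> carries the unknown count divided by the part factorials,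
    \<open>S\<close> is the product of scaled Poisson masses with the common mean
    \<open>m N\<close>, and \<open>R\<close> is the one with mean \<open>N\<close> at
    \<open>N\<close>.\<close>
  define I where "I = (\<lambda>N. real (AO (T N)) * L ^ N / (\<Prod>i<p. fact (n N i)))"
  define S where "S = (\<lambda>N. \<Prod>i<p. sqrt (m N) * exp (- m N) * m N ^ n N i / fact (n N i))"
  define R where "R = (\<lambda>N. sqrt (real N) * exp (- real N) * real N ^ N / fact N)"
  define v where "v = sqrt (2 * pi)"
  define w where "w = sqrt (1 - L)"
  define k where "k = p - 1"
  have k: "p = Suc k" "real p - 1 = real k"
    using assms(1) by (auto simp: k_def)
  have vw: "v > 0" "w > 0"
    using L1 by (auto simp: v_def w_def)
  have I: "(LINT t:{0..}|lborel. \<Prod>i<p. local_density L (n N i) t) = of_real (I N)" for N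
    using acyclic_orientations_integral[of "pverts (T N)" "c N" p L] fin c_less pL assms(1) sum_n[of N]
    by (simp add: AO_complete_multipartite[OF arcs] n_def I_def)
  have "(\<lambda>N. of_real (sqrt (m N) ^ p / sqrt (m N) * I N))
    \<longlonglongrightarrow> complex_of_real (1 / (L * exp (- L)) *
          ((1 / sqrt (2 * pi * (1 - L))) ^ p * sqrt (2 * pi * (1 - L) / p)))"
    using integral_prod_local_density_limit[OF L0 L1 _ m, of p n] close assms(1) unfolding I by simp
  then have lim_I: "(\<lambda>N. sqrt (m N) ^ p / sqrt (m N) * I N) \<longlonglongrightarrow>
      1 / (L * exp (- L)) * ((1 / (v * w)) ^ p * (v * w / sqrt p))"
    unfolding tendsto_of_real_iff by (simp add: v_def w_def real_sqrt_mult real_sqrt_divide)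
  have lim_S: "S \<longlonglongrightarrow> (1 / v) ^ p"
  proof -
    have "S \<longlonglongrightarrow> (\<Prod>i<p. 1 / sqrt (2 * pi))"
      unfolding S_def using close by (intro tendsto_prod poisson_local_limit m) auto
    then show ?thesis
      by (simp add: v_def)
  qed
  have lim_R: "R \<longlonglongrightarrow> 1 / v"
    unfolding R_def v_def by (intro poisson_local_limit filterlim_real_sequentially) simp
  \<comment> \<open>In \<open>R / S\<close> the exponentials and the powers of \<open>m N\<close>
    cancel because the part sizes sum to \<open>N\<close>. What remains exchanges the part
    factorials for \<open>fact N\<close>, produces \<open>real p ^ N\<close> and cancels the powers
    of \<open>sqrt (m N)\<close>. The last factor normalises the limit to 1.\<close>
  have "(\<lambda>N. sqrt (m N) ^ p / sqrt (m N) * I N * (R N / S N) * (L * k * w ^ k / sqrt p)) \<longlonglongrightarrow>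
      1 / (L * exp (- L)) * ((1 / (v * w)) ^ p * (v * w / sqrt p)) * ((1 / v) / (1 / v) ^ p) *
        (L * k * w ^ k / sqrt p)"
    using vw by (intro tendsto_intros lim_I lim_S lim_R) auto
  also have "1 / (L * exp (- L)) * ((1 / (v * w)) ^ p * (v * w / sqrt p)) * ((1 / v) / (1 / v) ^ p) *
        (L * k * w ^ k / sqrt p) = 1"
  proof -
    \<comment> \<open>The two roots of \<open>p\<close> come from the Gaussian integral and from
      \<open>R\<close>; with \<open>exp (- L) = k / p\<close> they leave the factor
      \<open>k = p - 1\<close>.\<close>
    have "exp (- L) * sqrt (real p) * sqrt (real p) = real k"
      using p by (simp add: mult.assoc exp_L k(2))
    moreover have "k > 0"
      using assms(1) k by simp
    moreover have "L * exp (- L) = L * k / p"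
      by (simp add: exp_L k)
    ultimately show ?thesis
      using L0 vw p unfolding k(1) by (simp add: power_divide power_mult_distrib divide_simps)
  qed
  finally have "(\<lambda>N. sqrt (m N) ^ p / sqrt (m N) * I N * (R N / S N) * (L * k * w ^ k / sqrt p)) \<longlonglongrightarrow> 1" .
  moreover have "\<forall>\<^sub>F N in sequentially. sqrt (m N) ^ p / sqrt (m N) * I N * (R N / S N) * (L * k * w ^ k / sqrt p) =
    real (AO (T N)) / (fact N /
            ((real p - 1) * (1 - L) powr ((real p - 1) / 2) * real p ^ N * L ^ (N + 1)))"
    using eventually_gt_at_top[of 0]
  proof eventually_elim
    case (elim N)
    have mN: "m N > 0" "real N = real p * m N"
      using elim p by (auto simp: m_def)
    have "(1 - L) powr (real k / 2) = ((1 - L) powr (1 / 2)) powr real k"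
      by (simp add: powr_powr)
    also have "\<dots> = w ^ k"
      using L1 by (simp add: powr_half_sqrt w_def powr_realpow)
    finally have w: "(1 - L) powr ((real p - 1) / 2) = w ^ k"
      by (simp add: k)
    have "S N = sqrt (m N) ^ p * exp (- m N) ^ p * m N ^ N / (\<Prod>i<p. fact (n N i))"
      by (simp add: S_def prod.distrib prod_dividef sum_n power_mult_distrib flip: power_sum)
    also have "exp (- m N) ^ p = exp (- real N)"
      by (simp add: mN flip: exp_of_nat_mult)
    finally have S: "S N = sqrt (m N) ^ p * exp (- real N) * m N ^ N / (\<Prod>i<p. fact (n N i))" .
    have R: "R N = sqrt p * sqrt (m N) * exp (- real N) * (real p ^ N * m N ^ N) / fact N"
      by (simp add: R_def mN(2) real_sqrt_mult power_mult_distrib)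
    have F: "(\<Prod>i<p. fact (n N i)) \<noteq> (0 :: real)"
      by simp
    have "sqrt (m N) ^ p / sqrt (m N) * I N * (R N / S N) * (L * k * w ^ k / sqrt p) =
        real (AO (T N)) * L ^ (N + 1) * real k * w ^ k * real p ^ N / fact N"
      unfolding S R I_def using mN(1) F p by (simp add: field_simps)
    then show ?case
      unfolding w by (simp add: k(2) mult_ac)
  qed
  ultimately have "(\<lambda>N. real (AO (T N)) / (fact N /
            ((real p - 1) * (1 - L) powr ((real p - 1) / 2) * real p ^ N * L ^ (N + 1)))) \<longlonglongrightarrow> 1"
    by (rule Lim_transform_eventually)
  then show ?thesis
    by (rule asymp_equivI')
qed

end
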